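(* Let $k$ be an algebraically closed field of characteristic zero, let $n>1$, let $\mathbf{x}=(x_1,\ldots,x_n)$ be indeterminates, and let $$P(\mathbf{x},z)=z^m+h_1(\mathbf{x})z^{m-1}+\cdots+h_{m-1}(\mathbf{x})z+h_m(\mathbf{x})\in k[[\mathbf{x}]][z]$$ be an irreducible Weierstrass polynomial. Then there exist an integer $p\ge 1$, an index $i$ with $1\le i\le n$, and a pyramid $\Gamma(\Delta)\subset\mathbb{R}^n$ with $$\Gamma(\Delta)\cap(-\mathbb{R}_0^n)=\{\mathbf{0}\},$$ such that all the roots of $P(\mathbf{x},z)=0$ are power series belonging to the ring $$k((x_n^{1/p}))\cdots((x_{i+1}^{1/p}))[[x_1^{1/p},\ldots,x_i^{1/p}]]$$ (that is, $P$ factors as $\prod_{j=1}^m(z-\varrho_j)$ with all $\varrho_j$ in this ring), and the Newton diagrams of all these roots are contained in $\Gamma(\Delta)$.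
   Context: A Weierstrass polynomial is a monic polynomial in $z$ over $k[[\mathbf{x}]]$ as displayed whose coefficients satisfy $h_j(\mathbf{0})=0$ for all $j=1,\ldots,m$. The ring $k((x_n^{1/p}))\cdots((x_{i+1}^{1/p}))[[x_1^{1/p},\ldots,x_i^{1/p}]]$ is the ring of formal power series in $x_1^{1/p},\ldots,x_i^{1/p}$ with coefficients in the iterated formal Laurent series field $k((x_n^{1/p}))((x_{n-1}^{1/p}))\cdots((x_{i+1}^{1/p}))$ (for $i=n$ it is $k[[x_1^{1/p},\ldots,x_n^{1/p}]]$); it contains $k[[\mathbf{x}]]$ in the natural way. The Newton diagram of an element of this ring is the set of exponents $(a_1,\ldots,a_n)\in\frac1p\mathbb{Z}^n\subset\mathbb{R}^n$ of the monomials $x_1^{a_1}\cdots x_n^{a_n}$ occurring in it with non-zero coefficient. $\mathbb{R}_0$ denotes the set of non-negative real numbers, and $-\mathbb{R}_0^n$ is the set of vectors with all coordinates $\le 0$. A pyramid in $\mathbb{R}^n$ is a set of the form $$\Gamma(\Delta)=\bigcup_{\mathbf{a}\in\Delta}\{\lambda\mathbf{a}\mid\lambda\ge 0\},$$ where $\Delta$ is the convex hull of a finite set of points whose affine span is a hyperplane of $\mathbb{R}^n$ not containing the origin $\mathbf{0}$. *)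

theory Defs
  imports "HOL-Analysis.Analysis" "HOL-Computational_Algebra.Polynomial"
begin

unbundle no fps_syntax (* reserves $ for vector components *)

text \<open>
  The variables \<open>x\<^sub>1, \<dots>, x\<^sub>n\<close> are indexed by a finite linearly ordered type \<open>'n\<close>, in increasing
  order, so that \<open>n = CARD('n)\<close>.  A series is a family of coefficients indexed by exponent vectors:
  vectors in \<open>nat ^ 'n\<close> for \<open>k[[x]]\<close>, vectors in \<open>real ^ 'n\<close> (with coordinates in
  \<open>(1/p) \<int>\<close>) for Laurent series in the \<open>x\<^sub>j ^ (1/p)\<close>.
\<close>

section \<open>The Cauchy product of coefficient families\<close>

definition mult_pairs :: "'e::comm_monoid_add set \<Rightarrow> 'e set \<Rightarrow> 'e \<Rightarrow> ('e \<times> 'e) set" where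
  "mult_pairs A B c = {(a, b). a \<in> A \<and> b \<in> B \<and> a + b = c}"

definition supp :: "('e \<Rightarrow> 'k::zero) \<Rightarrow> 'e set" where
  "supp f = {a. f a \<noteq> 0}"

text \<open>Below, this is only used where the index set of the sum is finite.\<close>

definition conv :: "('e::comm_monoid_add \<Rightarrow> 'k::comm_ring_1) \<Rightarrow> ('e \<Rightarrow> 'k) \<Rightarrow> 'e \<Rightarrow> 'k" where
  "conv f g c = (\<Sum>(a, b) \<in> mult_pairs (supp f) (supp g) c. f a * g b)"

definition setsum :: "'e::comm_monoid_add set \<Rightarrow> 'e set \<Rightarrow> 'e set" where
  "setsum A B = {a + b | a b. a \<in> A \<and> b \<in> B}"

lemma setsumI: "a \<in> A \<Longrightarrow> b \<in> B \<Longrightarrow> a + b \<in> setsum A B"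
  unfolding setsum_def by blast

lemma setsumE:
  assumes "x \<in> setsum A B"
  obtains a b where "x = a + b" "a \<in> A" "b \<in> B"
  using assms unfolding setsum_def by blast

definition fin_pairs :: "'e::comm_monoid_add set \<Rightarrow> 'e set \<Rightarrow> bool" where
  "fin_pairs A B \<longleftrightarrow> (\<forall>c. finite (mult_pairs A B c))"

lemma fin_pairsD: "fin_pairs A B \<Longrightarrow> finite (mult_pairs A B c)"
  by (simp add: fin_pairs_def)

lemma conv_eq_sum:
  assumes "finite X" "mult_pairs (supp f) (supp g) c \<subseteq> X" "\<And>a b. (a, b) \<in> X \<Longrightarrow> a + b = c"
  shows "conv f g c = (\<Sum>(a, b) \<in> X. f a * g b)"
  unfolding conv_def
proof (rule sum.mono_neutral_left[OF assms(1,2)])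
  show "\<forall>i\<in>X - mult_pairs (supp f) (supp g) c. (case i of (a, b) \<Rightarrow> f a * g b) = 0"
    using assms(3) by (auto simp: mult_pairs_def supp_def)
qed

lemma supp_conv: "supp (conv f g) \<subseteq> setsum (supp f) (supp g)"
proof
  fix c assume "c \<in> supp (conv f g)"
  then have "mult_pairs (supp f) (supp g) c \<noteq> {}"
    unfolding supp_def[of "conv f g"] conv_def by force
  then show "c \<in> setsum (supp f) (supp g)"
    by (auto simp: mult_pairs_def setsum_def)
qed

lemma conv_commute: "conv f g = conv g f"
proof
  fix c
  show "conv f g c = conv g f c"
    unfolding conv_def
    by (rule sum.reindex_bij_witness[where i = "\<lambda>(a,b). (b,a)" and j = "\<lambda>(a,b). (b,a)"])
       (auto simp: mult_pairs_def ac_simps)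
qed

lemma conv_add_left:
  assumes "fin_pairs (supp f) (supp h)" "fin_pairs (supp g) (supp h)"
  shows "conv (\<lambda>a. f a + g a) h c = conv f h c + conv g h c"
proof -
  let ?X = "mult_pairs (supp f) (supp h) c \<union> mult_pairs (supp g) (supp h) c"
  have fin: "finite ?X" using assms by (auto simp: fin_pairs_def)
  have "mult_pairs (supp (\<lambda>a. f a + g a)) (supp h) c \<subseteq> ?X"
    by (auto simp: mult_pairs_def supp_def)
  then have "conv (\<lambda>a. f a + g a) h c = (\<Sum>(a, b) \<in> ?X. (f a + g a) * h b)"
    by (intro conv_eq_sum fin) (auto simp: mult_pairs_def)
  also have "\<dots> = (\<Sum>(a, b) \<in> ?X. f a * h b) + (\<Sum>(a, b) \<in> ?X. g a * h b)"
    by (simp add: sum.distrib[symmetric] case_prod_beta ring_distribs)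
  also have "(\<Sum>(a, b) \<in> ?X. f a * h b) = conv f h c"
    by (rule conv_eq_sum[symmetric]) (use fin in \<open>auto simp: mult_pairs_def\<close>)
  also have "(\<Sum>(a, b) \<in> ?X. g a * h b) = conv g h c"
    by (rule conv_eq_sum[symmetric]) (use fin in \<open>auto simp: mult_pairs_def\<close>)
  finally show ?thesis .
qed

definition mult_triples :: "'e::comm_monoid_add set \<Rightarrow> 'e set \<Rightarrow> 'e set \<Rightarrow> 'e \<Rightarrow> ('e \<times> 'e \<times> 'e) set" where
  "mult_triples A B C c = {(a, b, d). a \<in> A \<and> b \<in> B \<and> d \<in> C \<and> a + b + d = c}"

lemma finite_mult_triples:
  assumes "fin_pairs A B" "fin_pairs (setsum A B) C"
  shows "finite (mult_triples A B C c)"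
proof -
  have "mult_triples A B C c \<subseteq>
    (\<Union>(e, d) \<in> mult_pairs (setsum A B) C c. (\<lambda>(a, b). (a, b, d)) ` mult_pairs A B e)"
    by (force simp: mult_triples_def mult_pairs_def setsum_def)
  moreover have "finite \<dots>"
    using assms by (auto simp: fin_pairs_def)
  ultimately show ?thesis by (rule finite_subset)
qed

lemma conv_conv:
  assumes "fin_pairs (supp f) (supp g)" "fin_pairs (setsum (supp f) (supp g)) (supp h)"
  shows "conv (conv f g) h c =
    (\<Sum>(a, b, d) \<in> mult_triples (supp f) (supp g) (supp h) c. f a * g b * h d)"
proof -
  let ?T = "mult_triples (supp f) (supp g) (supp h) c"
  let ?pr = "\<lambda>(a, b, d). (a + b, d)"
  have fin: "finite ?T" by (rule finite_mult_triples[OF assms])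
  have "conv (conv f g) h c = (\<Sum>(e, d) \<in> ?pr ` ?T. conv f g e * h d)"
  proof (rule conv_eq_sum)
    show "mult_pairs (supp (conv f g)) (supp h) c \<subseteq> ?pr ` ?T"
    proof
      fix x assume x: "x \<in> mult_pairs (supp (conv f g)) (supp h) c"
      obtain e d where [simp]: "x = (e, d)" by (cases x)
      from x have "e \<in> supp (conv f g)" and d: "d \<in> supp h" "e + d = c"
        by (auto simp: mult_pairs_def)
      then obtain a b where "a \<in> supp f" "b \<in> supp g" "e = a + b"
        using supp_conv[of f g] by (auto simp: setsum_def)
      with d have "(a, b, d) \<in> ?T" "x = ?pr (a, b, d)" by (auto simp: mult_triples_def)
      then show "x \<in> ?pr ` ?T" by blast
    qed
  qed (use fin in \<open>auto simp: mult_triples_def\<close>)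
  also have "\<dots> = (\<Sum>y \<in> ?pr ` ?T. \<Sum>(a, b, d) \<in> {x \<in> ?T. ?pr x = y}. f a * g b * h d)"
  proof (rule sum.cong[OF refl])
    fix y assume "y \<in> ?pr ` ?T"
    then obtain e d where y: "y = (e, d)" and d: "d \<in> supp h" and ed: "e + d = c"
      by (auto simp: mult_triples_def)
    have "conv f g e * h d = (\<Sum>(a, b) \<in> mult_pairs (supp f) (supp g) e. f a * g b * h d)"
      by (simp add: conv_def sum_distrib_right case_prod_beta)
    also have "\<dots> = (\<Sum>(a, b, d) \<in> {x \<in> ?T. ?pr x = y}. f a * g b * h d)"
      by (rule sum.reindex_bij_witness[where j = "\<lambda>(a, b). (a, b, d)" and i = "\<lambda>(a, b, d). (a, b)"])
         (use d ed in \<open>auto simp: mult_triples_def mult_pairs_def y\<close>)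
    finally show "(case y of (e, d) \<Rightarrow> conv f g e * h d) =
      (\<Sum>(a, b, d) \<in> {x \<in> ?T. ?pr x = y}. f a * g b * h d)" by (simp add: y)
  qed
  also have "\<dots> = (\<Sum>(a, b, d) \<in> ?T. f a * g b * h d)"
    by (rule sum.image_gen[OF fin, symmetric])
  finally show ?thesis .
qed

lemma conv_assoc:
  assumes "fin_pairs (supp f) (supp g)" "fin_pairs (setsum (supp f) (supp g)) (supp h)"
    "fin_pairs (supp h) (supp g)" "fin_pairs (setsum (supp h) (supp g)) (supp f)"
  shows "conv (conv f g) h c = conv f (conv g h) c"
proof -
  have "conv f (conv g h) c = conv (conv h g) f c"
    by (simp add: conv_commute)
  also have "\<dots> = conv (conv f g) h c"
    unfolding conv_conv[OF assms(1,2)] conv_conv[OF assms(3,4)]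
    by (rule sum.reindex_bij_witness[where j = "\<lambda>(a, b, d). (d, b, a)" and i = "\<lambda>(a, b, d). (d, b, a)"])
       (auto simp: mult_triples_def ac_simps)
  finally show ?thesis by simp
qed

lemma conv_one: "conv (\<lambda>a. if a = 0 then 1 else 0) f c = f c"
  by (subst conv_eq_sum[where X = "{(0, c)}"])
     (auto simp: mult_pairs_def supp_def split: if_splits)


section \<open>The ring \<open>k[[x]]\<close>\<close>

typedef (overloaded) ('k, 'n) mfps = "UNIV :: (nat ^ 'n \<Rightarrow> 'k::comm_ring_1) set"
  morphisms mfps_coeff Abs_mfps by simp

setup_lifting type_definition_mfps

lemma fin_pairs_nat: "fin_pairs A (B :: (nat ^ 'n::finite) set)"
  unfolding fin_pairs_def
proof
  fix c :: "nat ^ 'n"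
  let ?Y = "(vec_lambda ` (\<Pi>\<^sub>E j\<in>UNIV. {..c $ j})) :: (nat ^ 'n) set"
  have "finite ?Y" by (intro finite_imageI finite_PiE) auto
  moreover have "mult_pairs A B c \<subseteq> ?Y \<times> ?Y"
  proof
    fix x assume "x \<in> mult_pairs A B c"
    then have "fst x + snd x = c" by (auto simp: mult_pairs_def)
    then have *: "fst x $ j + snd x $ j = c $ j" for j
      by (metis vector_add_component)
    have "fst x = vec_lambda (\<lambda>j. fst x $ j)" "snd x = vec_lambda (\<lambda>j. snd x $ j)"
      by simp_all
    moreover have "(\<lambda>j. fst x $ j) \<in> (\<Pi>\<^sub>E j\<in>UNIV. {..c $ j})"
      "(\<lambda>j. snd x $ j) \<in> (\<Pi>\<^sub>E j\<in>UNIV. {..c $ j})"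
      using * by (auto simp: PiE_def extensional_def) (metis le_add1 le_add2)+
    ultimately have "fst x \<in> ?Y" "snd x \<in> ?Y" by blast+
    then show "x \<in> ?Y \<times> ?Y" by (cases x) auto
  qed
  ultimately show "finite (mult_pairs A B c)"
    by (meson finite_SigmaI finite_subset)
qed

instantiation mfps :: (comm_ring_1, finite) comm_ring_1
begin

lift_definition zero_mfps :: "('a, 'b) mfps" is "\<lambda>_. 0" .
lift_definition one_mfps :: "('a, 'b) mfps" is "\<lambda>e. if e = 0 then 1 else 0" .
lift_definition plus_mfps :: "('a, 'b) mfps \<Rightarrow> ('a, 'b) mfps \<Rightarrow> ('a, 'b) mfps"
  is "\<lambda>f g e. f e + g e" .
lift_definition minus_mfps :: "('a, 'b) mfps \<Rightarrow> ('a, 'b) mfps \<Rightarrow> ('a, 'b) mfps"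
  is "\<lambda>f g e. f e - g e" .
lift_definition uminus_mfps :: "('a, 'b) mfps \<Rightarrow> ('a, 'b) mfps"
  is "\<lambda>f e. - f e" .
lift_definition times_mfps :: "('a, 'b) mfps \<Rightarrow> ('a, 'b) mfps \<Rightarrow> ('a, 'b) mfps"
  is conv .

instance
proof
  fix a b c :: "('a, 'b) mfps"
  show "a * b * c = a * (b * c)"
    by transfer (rule ext, intro conv_assoc fin_pairs_nat)
  show "a * b = b * a"
    by transfer (rule conv_commute)
  show "1 * a = a"
    by transfer (rule ext, rule conv_one)
  show "(a + b) * c = a * c + b * c"
    by transfer (rule ext, intro conv_add_left fin_pairs_nat)
  show "(0 :: ('a, 'b) mfps) \<noteq> 1"
    by transfer (auto dest: fun_cong[of _ _ 0])
qed (transfer; simp add: algebra_simps)+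

end


section \<open>Iterated Laurent series with exponents in \<open>(1/p) \<int>\<close>\<close>

definition exp_lattice :: "nat \<Rightarrow> (real ^ 'n) set" where
  "exp_lattice p = {a. \<forall>j. real p * a $ j \<in> \<int>}"

text \<open>
  \<open>iter_laurent [v\<^sub>1, \<dots>, v\<^sub>r] S\<close> says that a series with exponents in a lattice
  \<open>exp_lattice p\<close> and support \<open>S\<close> is a Laurent series in the variable \<open>v\<^sub>1\<close>
  (finitely many negative exponents) all of whose coefficients are again iterated Laurent
  series in \<open>[v\<^sub>2, \<dots>, v\<^sub>r]\<close>; that is, it belongs to \<open>k((v\<^sub>r)) \<dots> ((v\<^sub>2))((v\<^sub>1))\<close>.  The set
  \<open>{a \<in> S. a $ v\<^sub>1 = c}\<close> is the support of the coefficient of the \<open>c\<close>-th power of \<open>v\<^sub>1\<close>.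
\<close>

primrec iter_laurent :: "'n list \<Rightarrow> (real ^ 'n) set \<Rightarrow> bool" where
  "iter_laurent [] S \<longleftrightarrow> True"
| "iter_laurent (v # vs) S \<longleftrightarrow>
     bdd_below ((\<lambda>a. a $ v) ` S) \<and> (\<forall>c. iter_laurent vs {a \<in> S. a $ v = c})"

lemma exp_lattice_mono: "p dvd q \<Longrightarrow> exp_lattice p \<subseteq> exp_lattice q"
proof -
  assume "p dvd q"
  then obtain r where q: "q = r * p" by (metis dvd_def mult.commute)
  have "real p * t \<in> \<int> \<Longrightarrow> real q * t \<in> \<int>" for t
    unfolding q by (simp add: mult.assoc Ints_mult)
  then show ?thesis by (auto simp: exp_lattice_def)
qed

lemma exp_lattice_add: "a \<in> exp_lattice p \<Longrightarrow> b \<in> exp_lattice p \<Longrightarrow> a + b \<in> exp_lattice p"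
  by (auto simp: exp_lattice_def distrib_left)

lemma iter_laurent_subset: "iter_laurent vs S \<Longrightarrow> T \<subseteq> S \<Longrightarrow> iter_laurent vs T"
proof (induction vs arbitrary: S T)
  case (Cons v vs)
  have "iter_laurent vs {a \<in> T. a $ v = c}" for c
    by (rule Cons.IH[of "{a \<in> S. a $ v = c}"]) (use Cons.prems in auto)
  moreover have "bdd_below ((\<lambda>a. a $ v) ` T)"
    by (rule bdd_below_mono[of "(\<lambda>a. a $ v) ` S"]) (use Cons.prems in auto)
  ultimately show ?case by simp
qed simp

lemma iter_laurent_Un: "iter_laurent vs S \<Longrightarrow> iter_laurent vs T \<Longrightarrow> iter_laurent vs (S \<union> T)"
proof (induction vs arbitrary: S T)
  case (Cons v vs)
  have "{a \<in> S \<union> T. a $ v = c} = {a \<in> S. a $ v = c} \<union> {a \<in> T. a $ v = c}" for c by auto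
  with Cons.prems Cons.IH show ?case by (simp add: image_Un)
qed simp

lemma iter_laurent_empty: "iter_laurent vs {}"
  by (induction vs) auto

lemma iter_laurent_UN:
  "finite I \<Longrightarrow> (\<And>i. i \<in> I \<Longrightarrow> iter_laurent vs (S i)) \<Longrightarrow> iter_laurent vs (\<Union>i\<in>I. S i)"
  by (induction I rule: finite_induct) (auto simp: iter_laurent_empty iter_laurent_Un)

lemma finite_lattice_interval:
  assumes "p \<ge> 1"
  shows "finite {s::real. l \<le> s \<and> s \<le> u \<and> real p * s \<in> \<int>}"
proof -
  have "{s. l \<le> s \<and> s \<le> u \<and> real p * s \<in> \<int>} \<subseteq>
      (\<lambda>z. of_int z / real p) ` {\<lfloor>real p * l\<rfloor>..\<lceil>real p * u\<rceil>}"
  proof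
    fix s assume s: "s \<in> {s. l \<le> s \<and> s \<le> u \<and> real p * s \<in> \<int>}"
    then have "real p * s \<in> \<int>" by simp
    then obtain z where z: "real p * s = of_int z" by (rule Ints_cases)
    have "real p * l \<le> real p * s" "real p * s \<le> real p * u"
      using s by (simp_all add: mult_left_mono)
    then have "z \<in> {\<lfloor>real p * l\<rfloor>..\<lceil>real p * u\<rceil>}"
      using floor_mono[of "real p * l" "of_int z"] ceiling_mono[of "of_int z" "real p * u"]
      unfolding z by simp
    moreover have "s = of_int z / real p" using assms by (simp flip: z)
    ultimately show "s \<in> (\<lambda>z. of_int z / real p) ` {\<lfloor>real p * l\<rfloor>..\<lceil>real p * u\<rceil>}" by blast
  qed
  then show ?thesis by (rule finite_subset) simp
qed

lemma finite_coord_splits: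
  assumes "p \<ge> 1" "S \<subseteq> exp_lattice p" "bdd_below ((\<lambda>a. a $ v) ` S)" "bdd_below ((\<lambda>a. a $ v) ` T)"
  shows "finite {s \<in> (\<lambda>a. a $ v) ` S. c - s \<in> (\<lambda>a. a $ v) ` T}"
proof -
  obtain l where l: "\<And>a. a \<in> S \<Longrightarrow> l \<le> a $ v" using assms(3) by (auto simp: bdd_below_def)
  obtain m where m: "\<And>a. a \<in> T \<Longrightarrow> m \<le> a $ v" using assms(4) by (auto simp: bdd_below_def)
  have "{s \<in> (\<lambda>a. a $ v) ` S. c - s \<in> (\<lambda>a. a $ v) ` T} \<subseteq>
      {s. l \<le> s \<and> s \<le> c - m \<and> real p * s \<in> \<int>}"
  proof
    fix s assume "s \<in> {s \<in> (\<lambda>a. a $ v) ` S. c - s \<in> (\<lambda>a. a $ v) ` T}"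
    then obtain a b where ab: "a \<in> S" "b \<in> T" "s = a $ v" "c - s = b $ v" by blast
    have "a \<in> exp_lattice p" using ab(1) assms(2) by blast
    then have "real p * s \<in> \<int>" unfolding ab(3) exp_lattice_def by simp
    with l[OF ab(1)] m[OF ab(2)] ab(3,4)
    show "s \<in> {s. l \<le> s \<and> s \<le> c - m \<and> real p * s \<in> \<int>}" by simp
  qed
  then show ?thesis by (rule finite_subset) (rule finite_lattice_interval[OF assms(1)])
qed

lemma iter_laurent_setsum:
  assumes "p \<ge> 1"
  shows "S \<subseteq> exp_lattice p \<Longrightarrow> iter_laurent vs S \<Longrightarrow> iter_laurent vs T \<Longrightarrow>
    iter_laurent vs (setsum S T)"
proof (induction vs arbitrary: S T)
  case (Cons v vs)
  have bdd: "bdd_below ((\<lambda>a. a $ v) ` S)" "bdd_below ((\<lambda>a. a $ v) ` T)" using Cons.prems by auto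
  then obtain l m where "\<And>a. a \<in> S \<Longrightarrow> l \<le> a $ v" "\<And>a. a \<in> T \<Longrightarrow> m \<le> a $ v"
    by (auto simp: bdd_below_def)
  then have "bdd_below ((\<lambda>a. a $ v) ` setsum S T)"
    by (intro bdd_belowI[of _ "l + m"]) (auto elim!: setsumE intro!: add_mono)
  moreover have "iter_laurent vs {a \<in> setsum S T. a $ v = c}" for c
  proof -
    let ?F = "{s \<in> (\<lambda>a. a $ v) ` S. c - s \<in> (\<lambda>a. a $ v) ` T}"
    have "{a \<in> setsum S T. a $ v = c} \<subseteq>
        (\<Union>s\<in>?F. setsum {a \<in> S. a $ v = s} {b \<in> T. b $ v = c - s})"
    proof
      fix x assume "x \<in> {a \<in> setsum S T. a $ v = c}"
      then have x: "x \<in> setsum S T" "x $ v = c" by simp_all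
      from x(1) obtain a b where ab: "x = a + b" "a \<in> S" "b \<in> T" by (rule setsumE)
      have b: "b $ v = c - a $ v" using x(2) unfolding ab(1) by simp
      have "a $ v \<in> ?F"
        using ab(2) imageI[OF ab(3), of "\<lambda>a. a $ v"] unfolding b by simp
      moreover have "x \<in> setsum {a' \<in> S. a' $ v = a $ v} {b \<in> T. b $ v = c - a $ v}"
        unfolding ab(1) by (rule setsumI) (use ab(2,3) b in simp_all)
      ultimately show "x \<in> (\<Union>s\<in>?F. setsum {a \<in> S. a $ v = s} {b \<in> T. b $ v = c - s})"
        by (rule UN_I)
    qed
    moreover have "iter_laurent vs (\<Union>s\<in>?F. setsum {a \<in> S. a $ v = s} {b \<in> T. b $ v = c - s})"
    proof (rule iter_laurent_UN)
      show "finite ?F" by (rule finite_coord_splits[OF assms Cons.prems(1) bdd])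
      show "iter_laurent vs (setsum {a \<in> S. a $ v = s} {b \<in> T. b $ v = c - s})" for s
      proof (rule Cons.IH)
        show "{a \<in> S. a $ v = s} \<subseteq> exp_lattice p" using Cons.prems(1) by blast
      qed (use Cons.prems(2,3) in simp_all)
    qed
    ultimately show ?thesis by (rule iter_laurent_subset[rotated])
  qed
  ultimately show ?case by simp
qed simp

lemma finite_mult_pairs_laurent:
  assumes "p \<ge> 1"
  shows "S \<subseteq> exp_lattice p \<Longrightarrow> iter_laurent vs S \<Longrightarrow> iter_laurent vs T \<Longrightarrow>
    (\<And>a b j. a \<in> S \<Longrightarrow> b \<in> S \<Longrightarrow> j \<notin> set vs \<Longrightarrow> a $ j = b $ j) \<Longrightarrow>
    (\<And>a b j. a \<in> T \<Longrightarrow> b \<in> T \<Longrightarrow> j \<notin> set vs \<Longrightarrow> a $ j = b $ j) \<Longrightarrow>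
    finite (mult_pairs S T c)"
proof (induction vs arbitrary: S T)
  case Nil
  have fin: "finite U" if "\<And>a b. a \<in> U \<Longrightarrow> b \<in> U \<Longrightarrow> a = b" for U :: "(real ^ 'a) set"
  proof (cases "U = {}")
    case False
    then obtain x where "x \<in> U" by blast
    with that have "U = {x}" by blast
    then show ?thesis by simp
  qed simp
  have "finite S"
  proof (rule fin)
    fix a b assume "a \<in> S" "b \<in> S"
    then have "a $ j = b $ j" for j by (rule Nil(4)) simp
    then show "a = b" unfolding vec_eq_iff by blast
  qed
  moreover have "finite T"
  proof (rule fin)
    fix a b assume "a \<in> T" "b \<in> T"
    then have "a $ j = b $ j" for j by (rule Nil(5)) simp
    then show "a = b" unfolding vec_eq_iff by blast
  qed
  moreover have "mult_pairs S T c \<subseteq> S \<times> T" by (auto simp: mult_pairs_def)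
  ultimately show ?case by (meson finite_SigmaI finite_subset)
next
  case (Cons v vs)
  have bdd: "bdd_below ((\<lambda>a. a $ v) ` S)" "bdd_below ((\<lambda>a. a $ v) ` T)" using Cons.prems(2,3) by simp_all
  let ?F = "{s \<in> (\<lambda>a. a $ v) ` S. c $ v - s \<in> (\<lambda>a. a $ v) ` T}"
  have "mult_pairs S T c \<subseteq>
      (\<Union>s\<in>?F. mult_pairs {a \<in> S. a $ v = s} {b \<in> T. b $ v = c $ v - s} c)"
  proof
    fix x assume "x \<in> mult_pairs S T c"
    then obtain a b where ab: "x = (a, b)" "a \<in> S" "b \<in> T" "a + b = c"
      by (auto simp: mult_pairs_def)
    then have b: "b $ v = c $ v - a $ v" by auto
    have "a $ v \<in> ?F"
      using ab(2) imageI[OF ab(3), of "\<lambda>a. a $ v"] unfolding b by simp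
    moreover have "x \<in> mult_pairs {a' \<in> S. a' $ v = a $ v} {b \<in> T. b $ v = c $ v - a $ v} c"
      unfolding ab(1) mult_pairs_def using ab(2,3,4) b by simp
    ultimately show "x \<in> (\<Union>s\<in>?F. mult_pairs {a \<in> S. a $ v = s} {b \<in> T. b $ v = c $ v - s} c)"
      by (rule UN_I)
  qed
  moreover have "finite (\<Union>s\<in>?F. mult_pairs {a \<in> S. a $ v = s} {b \<in> T. b $ v = c $ v - s} c)"
  proof (rule finite_UN_I)
    show "finite ?F"
      by (rule finite_coord_splits[OF assms Cons.prems(1) bdd])
    fix s
    let ?S = "{a \<in> S. a $ v = s}" and ?T = "{b \<in> T. b $ v = c $ v - s}"
    show "finite (mult_pairs ?S ?T c)"
    proof (rule Cons.IH)
      show "?S \<subseteq> exp_lattice p" using Cons.prems(1) by blast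
      show "iter_laurent vs ?S" "iter_laurent vs ?T" using Cons.prems(2,3) by simp_all
      show "a $ j = b $ j" if "a \<in> ?S" "b \<in> ?S" "j \<notin> set vs" for a b j
      proof (cases "j = v")
        case False
        then show ?thesis using that by (intro Cons.prems(4)) auto
      qed (use that in auto)
      show "a $ j = b $ j" if "a \<in> ?T" "b \<in> ?T" "j \<notin> set vs" for a b j
      proof (cases "j = v")
        case False
        then show ?thesis using that by (intro Cons.prems(5)) auto
      qed (use that in auto)
    qed
  qed
  ultimately show ?case by (rule finite_subset)
qed

text \<open>
  The union over all \<open>p \<ge> 1\<close> of the fields \<open>k((x\<^sub>n ^ (1/p))) \<dots> ((x\<^sub>1 ^ (1/p)))\<close>: one ring that contains
  all the rings in which roots are to be found.
\<close>

definition puiseux_support :: "(real ^ 'n::{finite, linorder}) set \<Rightarrow> bool" where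
  "puiseux_support S \<longleftrightarrow>
     (\<exists>p\<ge>1. S \<subseteq> exp_lattice p) \<and> iter_laurent (sorted_list_of_set UNIV) S"

lemma puiseux_support_subset: "puiseux_support S \<Longrightarrow> T \<subseteq> S \<Longrightarrow> puiseux_support T"
  unfolding puiseux_support_def by (meson iter_laurent_subset subset_trans)

lemma puiseux_support_common:
  assumes "puiseux_support S" "puiseux_support T"
  obtains p where "p \<ge> 1" "S \<subseteq> exp_lattice p" "T \<subseteq> exp_lattice p"
proof -
  from assms obtain p q where pq: "p \<ge> 1" "S \<subseteq> exp_lattice p" "q \<ge> 1" "T \<subseteq> exp_lattice q"
    unfolding puiseux_support_def by blast
  then have "p * q \<ge> 1" "S \<subseteq> exp_lattice (p * q)" "T \<subseteq> exp_lattice (p * q)"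
    using exp_lattice_mono[of p "p * q"] exp_lattice_mono[of q "p * q"] by auto
  then show ?thesis by (rule that)
qed

lemma puiseux_support_Un:
  assumes "puiseux_support S" "puiseux_support T"
  shows "puiseux_support (S \<union> T)"
proof -
  obtain p where p: "p \<ge> 1" "S \<subseteq> exp_lattice p" "T \<subseteq> exp_lattice p"
    using puiseux_support_common[OF assms] .
  then have "S \<union> T \<subseteq> exp_lattice p" by simp
  moreover have "iter_laurent (sorted_list_of_set UNIV) (S \<union> T)"
    using assms by (intro iter_laurent_Un) (simp_all add: puiseux_support_def)
  ultimately show ?thesis
    using p(1) unfolding puiseux_support_def by blast
qed

lemma puiseux_support_setsum:
  assumes "puiseux_support S" "puiseux_support T"
  shows "puiseux_support (setsum S T)"
proof -
  obtain p where p: "p \<ge> 1" "S \<subseteq> exp_lattice p" "T \<subseteq> exp_lattice p"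
    using puiseux_support_common[OF assms] .
  then have "setsum S T \<subseteq> exp_lattice p"
    by (auto elim!: setsumE intro!: exp_lattice_add)
  moreover have "iter_laurent (sorted_list_of_set UNIV) (setsum S T)"
    using assms by (intro iter_laurent_setsum[OF p(1,2)]) (simp_all add: puiseux_support_def)
  ultimately show ?thesis
    using p(1) unfolding puiseux_support_def by blast
qed

lemma fin_pairs_puiseux:
  assumes "puiseux_support S" "puiseux_support T"
  shows "fin_pairs S T"
proof -
  obtain p where p: "p \<ge> 1" "S \<subseteq> exp_lattice p" "T \<subseteq> exp_lattice p"
    using puiseux_support_common[OF assms] .
  have "iter_laurent (sorted_list_of_set UNIV) S" "iter_laurent (sorted_list_of_set UNIV) T"
    using assms by (simp_all add: puiseux_support_def)
  then show ?thesis
    unfolding fin_pairs_def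
    by (intro allI finite_mult_pairs_laurent[OF p(1,2), where vs = "sorted_list_of_set UNIV"]) auto
qed

lemma puiseux_support_nonneg:
  assumes "S \<subseteq> exp_lattice p" "p \<ge> 1" "\<And>a j. a \<in> S \<Longrightarrow> a $ j \<ge> 0"
  shows "puiseux_support S"
proof -
  have "(\<forall>a\<in>T. \<forall>j. a $ j \<ge> 0) \<Longrightarrow> iter_laurent vs T" for vs and T :: "(real, 'a) vec set"
    by (induction vs arbitrary: T) (auto intro!: bdd_belowI[of _ 0])
  with assms show ?thesis unfolding puiseux_support_def by blast
qed

typedef (overloaded) ('k, 'n) puiseux =
  "{f :: real ^ 'n::{finite, linorder} \<Rightarrow> 'k::comm_ring_1. puiseux_support (supp f)}"
  morphisms puiseux_coeff Abs_puiseux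
proof
  show "(\<lambda>_. 0) \<in> {f :: (real, 'n) vec \<Rightarrow> 'k. puiseux_support (supp f)}"
    using puiseux_support_nonneg[of "{}" 1] by (simp add: supp_def)
qed

setup_lifting type_definition_puiseux

instantiation puiseux :: (comm_ring_1, "{finite, linorder}") comm_ring_1
begin

lift_definition zero_puiseux :: "('a, 'b) puiseux" is "\<lambda>_. 0"
  using puiseux_support_nonneg[of "{}" 1] by (simp add: supp_def)
lift_definition one_puiseux :: "('a, 'b) puiseux" is "\<lambda>e. if e = 0 then 1 else 0"
  by (rule puiseux_support_nonneg[of _ 1]) (auto simp: supp_def exp_lattice_def split: if_splits)
lift_definition plus_puiseux :: "('a, 'b) puiseux \<Rightarrow> ('a, 'b) puiseux \<Rightarrow> ('a, 'b) puiseux"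
  is "\<lambda>f g e. f e + g e"
  by (erule (1) puiseux_support_subset[OF puiseux_support_Un]) (auto simp: supp_def)
lift_definition minus_puiseux :: "('a, 'b) puiseux \<Rightarrow> ('a, 'b) puiseux \<Rightarrow> ('a, 'b) puiseux"
  is "\<lambda>f g e. f e - g e"
  by (erule (1) puiseux_support_subset[OF puiseux_support_Un]) (auto simp: supp_def)
lift_definition uminus_puiseux :: "('a, 'b) puiseux \<Rightarrow> ('a, 'b) puiseux"
  is "\<lambda>f e. - f e"
  by (erule puiseux_support_subset) (auto simp: supp_def)
lift_definition times_puiseux :: "('a, 'b) puiseux \<Rightarrow> ('a, 'b) puiseux \<Rightarrow> ('a, 'b) puiseux"
  is conv
  by (erule (1) puiseux_support_subset[OF puiseux_support_setsum]) (rule supp_conv)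

instance
proof
  fix a b c :: "('a, 'b) puiseux"
  show "a * b * c = a * (b * c)"
    by transfer (rule ext, intro conv_assoc fin_pairs_puiseux puiseux_support_setsum)
  show "a * b = b * a"
    by transfer (rule conv_commute)
  show "1 * a = a"
    by transfer (rule ext, rule conv_one)
  show "(a + b) * c = a * c + b * c"
    by transfer (rule ext, intro conv_add_left fin_pairs_puiseux)
  show "(0 :: ('a, 'b) puiseux) \<noteq> 1"
    by transfer (auto dest: fun_cong[of _ _ 0])
qed (transfer; simp add: algebra_simps)+

end

definition newton_diagram :: "('k::comm_ring_1, 'n::{finite, linorder}) puiseux \<Rightarrow> (real ^ 'n::{finite, linorder}) set" where
  "newton_diagram f = supp (puiseux_coeff f)"

text \<open>
  The ring \<open>k((x\<^sub>n ^ (1/p))) \<dots> ((x\<^sub>i\<^sub>+\<^sub>1 ^ (1/p)))[[x\<^sub>1 ^ (1/p), \<dots>, x\<^sub>i ^ (1/p)]]\<close>: power series in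
  the variables up to \<open>i\<close>, where the coefficient at the exponents \<open>(c\<^sub>1, \<dots>, c\<^sub>i)\<close> is an
  iterated Laurent series in the remaining variables, the variable after \<open>i\<close> being outermost.
\<close>

definition root_support :: "nat \<Rightarrow> 'n::{finite, linorder} \<Rightarrow> (real ^ 'n::{finite, linorder}) set \<Rightarrow> bool" where
  "root_support p i S \<longleftrightarrow>
     S \<subseteq> exp_lattice p \<and>
     (\<forall>a\<in>S. \<forall>j\<le>i. 0 \<le> a $ j) \<and>
     (\<forall>c. iter_laurent (sorted_list_of_set {i<..}) {a \<in> S. \<forall>j\<le>i. a $ j = c $ j})"

definition root_ring :: "nat \<Rightarrow> 'n::{finite, linorder} \<Rightarrow> ('k::comm_ring_1, 'n::{finite, linorder}) puiseux set" where
  "root_ring p i = {f. root_support p i (newton_diagram f)}"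

text \<open>No element of the ring is lost by working inside the type \<open>puiseux\<close>, and it is a subring.\<close>

lemma root_support_imp_puiseux_support:
  assumes "p \<ge> 1" "root_support p i S"
  shows "puiseux_support S"
proof -
  have gen: "iter_laurent (us @ ws) T"
    if "\<And>a j. a \<in> T \<Longrightarrow> j \<in> set us \<Longrightarrow> 0 \<le> a $ j"
      "\<And>c. iter_laurent ws {a \<in> T. \<forall>j\<in>set us. a $ j = c $ j}"
    for us ws and T :: "(real, 'a) vec set"
    using that
  proof (induction us arbitrary: T)
    case Nil
    then show ?case by simp
  next
    case (Cons u us)
    have "iter_laurent (us @ ws) {a \<in> T. a $ u = d}" for d
    proof (rule Cons.IH)
      fix c :: "(real, 'a) vec"
      show "iter_laurent ws {a \<in> {a \<in> T. a $ u = d}. \<forall>j\<in>set us. a $ j = c $ j}"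
      proof (cases "u \<in> set us \<and> c $ u \<noteq> d")
        case True
        then have "{a \<in> {a \<in> T. a $ u = d}. \<forall>j\<in>set us. a $ j = c $ j} \<subseteq> {}" by force
        then show ?thesis by (rule iter_laurent_subset[OF iter_laurent_empty])
      next
        case False
        let ?c = "\<chi> j. if j = u then d else c $ j"
        show ?thesis
          by (rule iter_laurent_subset[OF Cons.prems(2)[of ?c]]) (use False in auto)
      qed
    qed (use Cons.prems in auto)
    moreover have "bdd_below ((\<lambda>a. a $ u) ` T)"
      using Cons.prems(1) by (intro bdd_belowI[of _ 0]) auto
    ultimately show ?case by simp
  qed
  have "sorted_list_of_set (UNIV :: 'a set) = sorted_list_of_set {..i} @ sorted_list_of_set {i<..}"
    by (rule sorted_distinct_set_unique) (auto simp: sorted_append)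
  moreover have "iter_laurent (sorted_list_of_set {..i} @ sorted_list_of_set {i<..}) S"
    by (rule gen) (use assms(2) in \<open>simp_all add: root_support_def Ball_def\<close>)
  ultimately show ?thesis using assms unfolding puiseux_support_def root_support_def by auto
qed


lemma root_support_iff:
  assumes "p \<ge> 1"
  shows "root_support p i S \<longleftrightarrow>
    puiseux_support S \<and> S \<subseteq> exp_lattice p \<and> (\<forall>a\<in>S. \<forall>j\<le>i. 0 \<le> a $ j)"
proof
  assume "root_support p i S"
  then show "puiseux_support S \<and> S \<subseteq> exp_lattice p \<and> (\<forall>a\<in>S. \<forall>j\<le>i. 0 \<le> a $ j)"
    using root_support_imp_puiseux_support[OF assms] by (auto simp: root_support_def)
next
  assume *: "puiseux_support S \<and> S \<subseteq> exp_lattice p \<and> (\<forall>a\<in>S. \<forall>j\<le>i. 0 \<le> a $ j)"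
  have gen: "iter_laurent (us @ ws) T \<Longrightarrow> iter_laurent ws {a \<in> T. \<forall>j\<in>set us. a $ j = c $ j}"
    for us ws and T :: "(real, 'a) vec set" and c
  proof (induction us arbitrary: T)
    case (Cons u us)
    from Cons.prems have "iter_laurent (us @ ws) {a \<in> T. a $ u = c $ u}" by simp
    then have "iter_laurent ws {a \<in> {a \<in> T. a $ u = c $ u}. \<forall>j\<in>set us. a $ j = c $ j}"
      by (rule Cons.IH)
    then show ?case by (rule iter_laurent_subset) auto
  qed simp
  have "sorted_list_of_set (UNIV :: 'a set) = sorted_list_of_set {..i} @ sorted_list_of_set {i<..}"
    by (rule sorted_distinct_set_unique) (auto simp: sorted_append)
  with * have "iter_laurent (sorted_list_of_set {..i} @ sorted_list_of_set {i<..}) S"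
    unfolding puiseux_support_def by simp
  from gen[OF this] have "iter_laurent (sorted_list_of_set {i<..}) {a \<in> S. \<forall>j\<le>i. a $ j = c $ j}" for c
    by (simp add: Ball_def)
  with * show "root_support p i S"
    unfolding root_support_def by blast
qed

lemma root_ring_add: "p \<ge> 1 \<Longrightarrow> f \<in> root_ring p i \<Longrightarrow> g \<in> root_ring p i \<Longrightarrow> f + g \<in> root_ring p i"
proof -
  assume p: "p \<ge> 1" and fg: "f \<in> root_ring p i" "g \<in> root_ring p i"
  have "newton_diagram (f + g) \<subseteq> newton_diagram f \<union> newton_diagram g"
    by (auto simp: newton_diagram_def supp_def plus_puiseux.rep_eq)
  moreover have "puiseux_support (newton_diagram (f + g))"
    using puiseux_coeff[of "f + g"] by (simp add: newton_diagram_def)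
  ultimately show ?thesis
    using fg unfolding root_ring_def root_support_iff[OF p] by blast
qed

lemma root_ring_uminus: "f \<in> root_ring p i \<Longrightarrow> - f \<in> root_ring p i"
  by (simp add: root_ring_def newton_diagram_def supp_def uminus_puiseux.rep_eq)

lemma root_ring_one: "p \<ge> 1 \<Longrightarrow> 1 \<in> root_ring p i"
  unfolding root_ring_def root_support_iff newton_diagram_def
  using puiseux_coeff[of 1] by (auto simp: supp_def one_puiseux.rep_eq exp_lattice_def split: if_splits)

lemma root_ring_mult: "p \<ge> 1 \<Longrightarrow> f \<in> root_ring p i \<Longrightarrow> g \<in> root_ring p i \<Longrightarrow> f * g \<in> root_ring p i"
proof -
  assume p: "p \<ge> 1" and fg: "f \<in> root_ring p i" "g \<in> root_ring p i"
  have "newton_diagram (f * g) \<subseteq> setsum (newton_diagram f) (newton_diagram g)"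
    using supp_conv by (simp add: newton_diagram_def times_puiseux.rep_eq)
  moreover have "puiseux_support (newton_diagram (f * g))"
    using puiseux_coeff[of "f * g"] by (simp add: newton_diagram_def)
  moreover have "setsum (newton_diagram f) (newton_diagram g) \<subseteq> exp_lattice p"
    "\<forall>a\<in>setsum (newton_diagram f) (newton_diagram g). \<forall>j\<le>i. 0 \<le> a $ j"
    using fg unfolding root_ring_def root_support_iff[OF p]
    by (auto elim!: setsumE intro!: exp_lattice_add add_nonneg_nonneg)
  ultimately show ?thesis
    unfolding root_ring_def root_support_iff[OF p] by blast
qed


section \<open>The inclusion of \<open>k[[x]]\<close>\<close>

definition real_exp :: "nat ^ 'n \<Rightarrow> real ^ 'n" where
  "real_exp e = (\<chi> j. real (e $ j))"

lemma inj_real_exp: "inj real_exp"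
  by (rule injI) (simp add: real_exp_def vec_eq_iff)

lemma real_exp_add: "real_exp (a + b) = real_exp a + real_exp b"
  by (simp add: real_exp_def vec_eq_iff)

lift_definition puiseux_of_mfps :: "('k::comm_ring_1, 'n::{finite, linorder}) mfps \<Rightarrow> ('k, 'n) puiseux"
  is "\<lambda>f a. if a \<in> range real_exp then f (inv real_exp a) else 0"
  by (rule puiseux_support_nonneg[of _ 1])
     (auto simp: supp_def exp_lattice_def real_exp_def split: if_splits)

lemma puiseux_of_mfps_add: "puiseux_of_mfps (f + g) = puiseux_of_mfps f + puiseux_of_mfps g"
  by transfer auto

lemma puiseux_of_mfps_one: "puiseux_of_mfps 1 = 1"
proof transfer
  have z: "real_exp (0 :: (nat, 'b) vec) = 0" by (simp add: real_exp_def vec_eq_iff)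
  have "inv real_exp (0 :: (real, 'b) vec) = 0"
    using inv_f_f[OF inj_real_exp, of "0 :: (nat, 'b) vec"] unfolding z .
  moreover have "0 \<in> range (real_exp :: (nat, 'b) vec \<Rightarrow> _)"
    using rangeI[of real_exp "0 :: (nat, 'b) vec"] unfolding z .
  moreover have "a = 0" if "a \<in> range real_exp" "inv real_exp a = 0" for a :: "(real, 'b) vec"
    using f_inv_into_f[OF that(1)] that(2) z by simp
  ultimately show "(\<lambda>a::(real, 'b) vec. if a \<in> range real_exp then if inv real_exp a = 0 then 1 else 0 else 0) =
    (\<lambda>a. if a = 0 then 1 else (0::'a))"
    by (intro ext) auto
qed

lemma puiseux_of_mfps_mult: "puiseux_of_mfps (f * g) = puiseux_of_mfps f * puiseux_of_mfps g"
proof transfer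
  fix f g :: "(nat, 'b) vec \<Rightarrow> 'a"
  let ?E = "\<lambda>f a. if a \<in> range real_exp then f (inv real_exp a) else 0"
  have E: "?E h (real_exp e) = h e" for h :: "(nat, 'b) vec \<Rightarrow> 'a" and e
    by (simp add: inv_f_f[OF inj_real_exp])
  have suppE: "supp (?E h) = real_exp ` supp h" for h :: "(nat, 'b) vec \<Rightarrow> 'a"
    using inj_real_exp by (auto simp: supp_def inv_f_f[OF inj_real_exp] dest: injD)
  show "?E (conv f g) = conv (?E f) (?E g)"
  proof
    fix a :: "(real, 'b) vec"
    show "?E (conv f g) a = conv (?E f) (?E g) a"
    proof (cases "a \<in> range real_exp")
      case True
      then obtain e where a: "a = real_exp e" by auto
      have "conv f g e = conv (?E f) (?E g) a"
        unfolding conv_def suppE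
      proof (rule sum.reindex_bij_witness[where j = "map_prod real_exp real_exp"
              and i = "map_prod (inv real_exp) (inv real_exp)"])
        fix x assume "x \<in> mult_pairs (real_exp ` supp f) (real_exp ` supp g) a"
        then show "map_prod (inv real_exp) (inv real_exp) x \<in> mult_pairs (supp f) (supp g) e"
          by (auto simp: mult_pairs_def a inv_f_f[OF inj_real_exp] simp flip: real_exp_add
              dest: injD[OF inj_real_exp])
      qed (auto simp: mult_pairs_def a real_exp_add inv_f_f[OF inj_real_exp])
      then show ?thesis by (simp only: a E)
    next
      case False
      have "mult_pairs (real_exp ` supp f) (real_exp ` supp g) a = {}"
        using False by (auto simp: mult_pairs_def simp flip: real_exp_add)
      then show ?thesis using False by (simp add: conv_def suppE)
    qed
  qed
qed


section \<open>Weierstrass polynomials and pyramids\<close>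

definition weierstrass_polynomial :: "('k::comm_ring_1, 'n::finite) mfps poly \<Rightarrow> bool" where
  "weierstrass_polynomial P \<longleftrightarrow>
     lead_coeff P = 1 \<and> (\<forall>l<degree P. mfps_coeff (coeff P l) 0 = 0)"

definition pyramid_base :: "'a::euclidean_space set \<Rightarrow> bool" where
  "pyramid_base D \<longleftrightarrow>
     (\<exists>V. finite V \<and> D = convex hull V) \<and>
     (\<exists>u b. u \<noteq> 0 \<and> affine hull D = {x. u \<bullet> x = b}) \<and>
     0 \<notin> affine hull D"

definition pyramid :: "'a::euclidean_space set \<Rightarrow> 'a set" where
  "pyramid D = (\<Union>a\<in>D. {t *\<^sub>R a | t. 0 \<le> t})"

end

theory Submission
  imports Defs
begin

text \<open>
  All monic polynomials over the ring of series with support in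
  \<open>(1/p) \<int>\<^sup>n \<inter> C\<^sub>N\<close> for some \<open>p\<close> and \<open>N\<close> split over this ring.  Here the \<open>C\<^sub>N\<close> form an
  increasing family of simplicial cones, given by unitriangular linear forms, whose union is the
  set of lexicographically non-negative vectors.  A non-zero series with lexicographically
  minimal exponent \<open>v\<close> is \<open>x\<^sup>v\<close> times a series in the ring with non-zero constant term (possibly
  with a larger \<open>N\<close>, by Dickson's lemma), so the ring behaves like a valuation ring with residue
  field \<open>k\<close> and divisible value group.  As in Newton--Puiseux, one removes the coefficient of
  \<open>z\<^sup>d\<^sup>-\<^sup>1\<close> and substitutes \<open>z = x\<^sup>c w\<close> with \<open>c\<close> the smallest slope; the reduction modulo the
  maximal ideal then has at least two distinct roots and Hensel's lemma factors the polynomial.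
  A vector of \<open>C\<^sub>N\<close> with non-positive coordinates vanishes, and the first coordinate is
  non-negative on \<open>C\<^sub>N\<close>, so one may take \<open>i = 1\<close>.
\<close>

section \<open>Cones of lexicographically non-negative vectors\<close>

text \<open>The forms defining \<open>C\<^sub>N\<close>. With this recursive choice \<open>C\<^sub>N\<close> increases with \<open>N\<close>.\<close>

function skew :: "nat \<Rightarrow> real ^ 'n::{finite, linorder} \<Rightarrow> 'n \<Rightarrow> real" where
  "skew N a i = a $ i + real N * (\<Sum>j\<in>{..<i}. skew N a j)"
  by auto
termination
  by (relation "Wellfounded.measure (\<lambda>(N, a, i). card {..<i})") (auto intro!: psubset_card_mono)

declare skew.simps [simp del]

lemma finite_linorder_induct [case_names less]:
  fixes i :: "'n::{finite, linorder}"
  assumes "\<And>i. (\<And>j. j < i \<Longrightarrow> Q j) \<Longrightarrow> Q i"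
  shows "Q i"
proof (induction "card {..<i}" arbitrary: i rule: less_induct)
  case less
  then show ?case
    by (rule assms) (auto intro!: less psubset_card_mono)
qed

lemma skew_add: "skew N (a + b) i = skew N a i + skew N b i"
proof (induction i rule: finite_linorder_induct)
  case (less i)
  then show ?case
    by (simp add: skew.simps[of N _ i] sum.distrib algebra_simps)
qed

lemma skew_scaleR: "skew N (t *\<^sub>R a) i = t * skew N a i"
proof (induction i rule: finite_linorder_induct)
  case (less i)
  then show ?case
    by (simp add: skew.simps[of N _ i] sum_distrib_left algebra_simps)
qed

lemma skew_zero [simp]: "skew N 0 i = 0"
  using skew_scaleR[of N 0 0 i] by simp

lemma skew_minus: "skew N (a - b) i = skew N a i - skew N b i"
  using skew_add[of N "a - b" b i] by simp

lemma skew_cong: "(\<And>j. j \<le> i \<Longrightarrow> a $ j = b $ j) \<Longrightarrow> skew N a i = skew N b i"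
proof (induction i rule: finite_linorder_induct)
  case (less i)
  then show ?case
    by (simp add: skew.simps[of N _ i])
qed

lemma skew_eq_0:
  assumes "\<And>i. skew N a i = 0"
  shows "a = 0"
proof -
  have "a $ i = 0" for i
    using assms skew.simps[of N a i] by simp
  then show ?thesis by (simp add: vec_eq_iff)
qed

text \<open>The forms have integer coefficients. Scaled by \<open>p\<close> they turn lattice points
  of a cone into vectors of natural numbers, to which Dickson's lemma and recursion apply.\<close>

lemma skew_Ints:
  assumes "a \<in> exp_lattice p"
  shows "real p * skew N a i \<in> \<int>"
proof (induction i rule: finite_linorder_induct)
  case (less i)
  have "real p * skew N a i = real p * a $ i + real N * (\<Sum>j\<in>{..<i}. real p * skew N a j)"
    by (simp add: skew.simps[of N a i] sum_distrib_left algebra_simps)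
  also have "\<dots> \<in> \<int>"
  proof (rule Ints_add)
    show "real p * a $ i \<in> \<int>" using assms by (simp add: exp_lattice_def)
    show "real N * (\<Sum>j\<in>{..<i}. real p * skew N a j) \<in> \<int>"
      by (rule Ints_mult[OF Ints_of_nat Ints_sum]) (rule less, simp)
  qed
  finally show ?case .
qed

definition skew_cone :: "nat \<Rightarrow> (real ^ 'n::{finite, linorder}) set" where
  "skew_cone N = {a. \<forall>i. 0 \<le> skew N a i}"

lemma cone_zero [simp]: "0 \<in> skew_cone N"
  by (simp add: skew_cone_def)

lemma cone_add: "a \<in> skew_cone N \<Longrightarrow> b \<in> skew_cone N \<Longrightarrow> a + b \<in> skew_cone N"
  by (simp add: skew_cone_def skew_add)

lemma cone_scaleR: "0 \<le> t \<Longrightarrow> a \<in> skew_cone N \<Longrightarrow> t *\<^sub>R a \<in> skew_cone N"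
  by (simp add: skew_cone_def skew_scaleR)

lemma cone_mono:
  assumes "N \<le> M"
  shows "skew_cone N \<subseteq> skew_cone M"
proof
  fix a :: "real ^ 'n::{finite, linorder}" assume a: "a \<in> skew_cone N"
  \<comment> \<open>Even the single forms grow with \<open>N\<close>: the earlier ones are
    non-negative, so a larger factor in front of their sum can only help.\<close>
  have "skew N a i \<le> skew M a i" for i
  proof (induction i rule: finite_linorder_induct)
    case (less i)
    have "real N * (\<Sum>j\<in>{..<i}. skew N a j) \<le> real M * (\<Sum>j\<in>{..<i}. skew M a j)"
      using assms less a by (intro mult_mono sum_mono sum_nonneg) (auto simp: skew_cone_def)
    then show ?case
      by (simp add: skew.simps[of N a i] skew.simps[of M a i])
  qed
  with a show "a \<in> skew_cone M"
    by (force simp: skew_cone_def intro: order_trans)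
qed

lemma cone_nonneg:
  assumes "\<And>i. 0 \<le> a $ i"
  shows "a \<in> skew_cone N"
proof -
  have "0 \<le> skew N a i" for i
  proof (induction i rule: finite_linorder_induct)
    case (less i)
    then show ?case
      using assms by (auto simp: skew.simps[of N a i] intro!: add_nonneg_nonneg mult_nonneg_nonneg sum_nonneg)
  qed
  then show ?thesis by (simp add: skew_cone_def)
qed

text \<open>The condition on the pyramid. By induction along the variables: once all earlier forms
  vanish, \<open>skew N a i\<close> is the coordinate \<open>a $ i\<close>, which is then both
  non-negative and non-positive.\<close>

lemma cone_nonpos_eq_0:
  assumes "a \<in> skew_cone N" "\<And>i. a $ i \<le> 0"
  shows "a = 0"
proof (rule skew_eq_0)
  fix i show "skew N a i = 0"
  proof (induction i rule: finite_linorder_induct)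
    case (less i)
    then have "skew N a i = a $ i"
      by (simp add: skew.simps[of N a i])
    moreover have "0 \<le> skew N a i" "a $ i \<le> 0"
      using assms by (simp_all add: skew_cone_def)
    ultimately show ?case by simp
  qed
qed

text \<open>Up to sign the first non-zero coordinate is positive, and a large multiple of it
  outweighs all later coordinates.\<close>

lemma cone_total: "\<exists>N. a \<in> skew_cone N \<or> - a \<in> skew_cone N"
proof (cases "a = 0")
  case False
  then have ne: "{j. a $ j \<noteq> 0} \<noteq> {}" by (auto simp: vec_eq_iff)
  define j where "j = Min {j. a $ j \<noteq> 0}"
  have j: "a $ j \<noteq> 0" using Min_in[OF _ ne] by (simp add: j_def)
  have below: "a $ i = 0" if "i < j" for i
  proof (rule ccontr)
    assume "a $ i \<noteq> 0"
    then have "j \<le> i" unfolding j_def by (intro Min_le) auto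
    with that show False by simp
  qed
  define b where "b = (if a $ j > 0 then a else - a)"
  have bj: "b $ j > 0" and b0: "\<And>i. i < j \<Longrightarrow> b $ i = 0"
    using j below by (auto simp: b_def)
  \<comment> \<open>\<open>N\<close> times the leading coordinate is to be at least the norm, which
    bounds every coordinate.\<close>
  obtain N where N: "norm b / b $ j \<le> real N" using real_arch_simple by blast
  have low: "skew N b i = 0" if "i < j" for i
    using skew_cong[of i b 0 N] b0 that by auto
  have at: "skew N b j = b $ j" by (simp add: skew.simps[of N b j] low)
  have "0 \<le> skew N b i" for i
  proof (induction i rule: finite_linorder_induct)
    case (less i)
    consider "i < j" | "i = j" | "j < i" by force
    then show ?case
    proof cases
      case 3
      have "- norm b \<le> b $ i"
        using component_le_norm_cart[of b i] by (simp add: abs_le_iff)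
      moreover have "norm b \<le> real N * b $ j"
        using N bj by (simp add: field_simps)
      moreover have "b $ j \<le> (\<Sum>k\<in>{..<i}. skew N b k)"
        unfolding at[symmetric] using 3 less by (intro member_le_sum) auto
      then have "real N * b $ j \<le> real N * (\<Sum>k\<in>{..<i}. skew N b k)"
        by (intro mult_left_mono) auto
      ultimately show ?thesis unfolding skew.simps[of N b i] by linarith
    qed (use low at bj in auto)
  qed
  then have "b \<in> skew_cone N" by (simp add: skew_cone_def)
  then show ?thesis by (auto simp: b_def split: if_splits)
qed auto

text \<open>The set of lexicographically non-negative vectors.\<close>

definition lexnn :: "(real ^ 'n::{finite, linorder}) set" where
  "lexnn = (\<Union>N. skew_cone N)"

lemma lexnn_total: "a \<in> lexnn \<or> - a \<in> lexnn"
  using cone_total[of a] by (auto simp: lexnn_def)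

lemma lexnn_add:
  assumes "a \<in> lexnn" "b \<in> lexnn"
  shows "a + b \<in> lexnn"
proof -
  obtain N M where "a \<in> skew_cone N" "b \<in> skew_cone M" using assms by (auto simp: lexnn_def)
  then have "a \<in> skew_cone (max N M)" "b \<in> skew_cone (max N M)"
    using cone_mono[of N "max N M"] cone_mono[of M "max N M"] by auto
  then show ?thesis by (auto simp: lexnn_def intro: cone_add)
qed

lemma lexnn_scaleR: "0 \<le> t \<Longrightarrow> a \<in> lexnn \<Longrightarrow> t *\<^sub>R a \<in> lexnn"
  by (auto simp: lexnn_def intro: cone_scaleR)

section \<open>Minima in the lexicographic order\<close>

lemma lexnn_minimum:
  assumes "finite I" "I \<noteq> {}"
  shows "\<exists>i\<in>I. \<forall>j\<in>I. w j - w i \<in> lexnn"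
  using assms
proof (induction I rule: finite_ne_induct)
  case (singleton x)
  then show ?case by (auto simp: lexnn_def)
next
  case (insert x I)
  then obtain i where i: "i \<in> I" "\<And>j. j \<in> I \<Longrightarrow> w j - w i \<in> lexnn" by blast
  show ?case
  proof (cases "w x - w i \<in> lexnn")
    case True
    with i show ?thesis by blast
  next
    case False
    then have "w i - w x \<in> lexnn" using lexnn_total[of "w x - w i"] by simp
    then have "w j - w x \<in> lexnn" if "j \<in> I" for j
      using lexnn_add[OF i(2)[OF that], of "w i - w x"] by simp
    moreover have "w x - w x \<in> lexnn" by (auto simp: lexnn_def)
    ultimately show ?thesis by blast
  qed
qed

text \<open>Induction on \<open>V\<close>: let \<open>F\<close> serve for the old coordinates.
  Elements with \<open>b v\<close> at least \<open>M\<close>, a bound for the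
  \<open>v\<close>-values in \<open>F\<close>, lie above an element of \<open>F\<close> in all
  coordinates; each of the finitely many levels \<open>b v = m\<close> below \<open>M\<close> has
  its own finite set \<open>G m\<close>.\<close>

lemma dickson:
  fixes S :: "('v \<Rightarrow> nat) set"
  assumes "finite V"
  shows "\<exists>F. finite F \<and> F \<subseteq> S \<and> (\<forall>b\<in>S. \<exists>f\<in>F. \<forall>v\<in>V. f v \<le> b v)"
  using assms
proof (induction V arbitrary: S rule: finite_induct)
  case empty
  show ?case
  proof (cases "S = {}")
    case False
    then obtain b where "b \<in> S" by blast
    then show ?thesis by (intro exI[of _ "{b}"]) auto
  qed auto
next
  case (insert v V)
  obtain F where F: "finite F" "F \<subseteq> S" "\<And>b. b \<in> S \<Longrightarrow> \<exists>f\<in>F. \<forall>u\<in>V. f u \<le> b u"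
    using insert.IH[of S] by blast
  obtain G where G: "\<And>m. finite (G m)" "\<And>m. G m \<subseteq> {b \<in> S. b v = m}"
    "\<And>m b. b \<in> S \<Longrightarrow> b v = m \<Longrightarrow> \<exists>f\<in>G m. \<forall>u\<in>V. f u \<le> b u"
  proof -
    have "\<forall>m. \<exists>F. finite F \<and> F \<subseteq> {b \<in> S. b v = m} \<and>
        (\<forall>b\<in>{b \<in> S. b v = m}. \<exists>f\<in>F. \<forall>u\<in>V. f u \<le> b u)"
      using insert.IH by blast
    then obtain G where "\<forall>m. finite (G m) \<and> G m \<subseteq> {b \<in> S. b v = m} \<and>
        (\<forall>b\<in>{b \<in> S. b v = m}. \<exists>f\<in>G m. \<forall>u\<in>V. f u \<le> b u)"
      by (rule choice[THEN exE])
    then show ?thesis by (intro that[of G]) blast+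
  qed
  define M where "M = Max (insert 0 ((\<lambda>f. f v) ` F))"
  have M: "f v \<le> M" if "f \<in> F" for f
    using that F(1) by (auto simp: M_def intro: Max_ge)
  have "\<exists>f\<in>F \<union> (\<Union>m<M. G m). \<forall>u\<in>insert v V. f u \<le> b u" if b: "b \<in> S" for b
  proof (cases "b v < M")
    case True
    obtain f where "f \<in> G (b v)" "\<forall>u\<in>V. f u \<le> b u" using G(3)[OF b refl] by blast
    with G(2)[of "b v"] True show ?thesis by (intro bexI[of _ f]) auto
  next
    case False
    obtain f where "f \<in> F" "\<forall>u\<in>V. f u \<le> b u" using F(3)[OF b] by blast
    with M[of f] False show ?thesis by (intro bexI[of _ f]) auto
  qed
  then show ?case
    using F(1,2) G(1,2) by (intro exI[of _ "F \<union> (\<Union>m<M. G m)"]) blast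
qed

lemma cone_lattice_nat:
  assumes "a \<in> skew_cone N" "a \<in> exp_lattice p"
  shows "real (nat \<lfloor>real p * skew N a i\<rfloor>) = real p * skew N a i"
proof -
  have "real_of_int \<lfloor>real p * skew N a i\<rfloor> = real p * skew N a i"
    using skew_Ints[OF assms(2)] by simp
  moreover have "0 \<le> real p * skew N a i"
    using assms(1) by (simp add: skew_cone_def)
  ultimately show ?thesis by simp
qed

text \<open>Dickson's lemma, applied to the values of the forms, gives a finite \<open>T\<close>
  such that each \<open>b\<close> in \<open>S\<close> has \<open>b - f\<close> in
  \<open>skew_cone N\<close> for some \<open>f\<close> in \<open>T\<close>. The lexicographic
  minimum \<open>a\<close> of \<open>T\<close> then works: \<open>b - a = (b - f) + (f - a)\<close>,
  and the finitely many \<open>f - a\<close> lie in a common, possibly larger cone.\<close>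

lemma cone_lattice_minimum:
  fixes S :: "(real ^ 'n::{finite, linorder}) set"
  assumes "p \<ge> 1" "S \<subseteq> skew_cone N \<inter> exp_lattice p" "S \<noteq> {}"
  shows "\<exists>a\<in>S. \<exists>M. \<forall>b\<in>S. b - a \<in> skew_cone M"
proof -
  define h where "h a = (\<lambda>i. nat \<lfloor>real p * skew N a i\<rfloor>)" for a :: "(real, 'n) vec"
  obtain F where F: "finite F" "F \<subseteq> h ` S" "\<And>b. b \<in> h ` S \<Longrightarrow> \<exists>f\<in>F. \<forall>v. f v \<le> b v"
    using dickson[of "UNIV :: 'n set" "h ` S"] by auto
  obtain T where T: "finite T" "T \<subseteq> S" "F = h ` T"
    using finite_subset_image[OF F(1,2)] by blast
  have dom: "\<exists>f\<in>T. b - f \<in> skew_cone N" if b: "b \<in> S" for b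
  proof -
    obtain f where f: "f \<in> T" "\<And>v. h f v \<le> h b v" using F(3)[of "h b"] b T(3) by auto
    have "0 \<le> skew N (b - f) i" for i
    proof -
      have "real (h f i) \<le> real (h b i)" using f(2) by simp
      then have "real p * skew N f i \<le> real p * skew N b i"
      proof -
        have "b \<in> skew_cone N" "b \<in> exp_lattice p" "f \<in> skew_cone N" "f \<in> exp_lattice p"
          using assms(2) b f(1) T(2) by auto
        then show ?thesis
          using \<open>real (h f i) \<le> real (h b i)\<close> unfolding h_def by (simp only: cone_lattice_nat)
      qed
      with assms(1) show ?thesis by (simp add: skew_minus)
    qed
    with f(1) show ?thesis by (auto simp: skew_cone_def)
  qed
  have "T \<noteq> {}" using assms(3) dom by blast
  with lexnn_minimum[OF T(1), of "\<lambda>x. x"] obtain a where a: "a \<in> T" "\<And>f. f \<in> T \<Longrightarrow> f - a \<in> lexnn"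
    by auto
  then obtain m where m: "\<And>f. f \<in> T \<Longrightarrow> f - a \<in> skew_cone (m f)"
    unfolding lexnn_def by simp metis
  define M where "M = Max (insert N (m ` T))"
  have "b - a \<in> skew_cone M" if b: "b \<in> S" for b
  proof -
    obtain f where f: "f \<in> T" "b - f \<in> skew_cone N" using dom[OF b] by blast
    have "N \<le> M" "m f \<le> M" using T(1) f(1) by (auto simp: M_def)
    then have "b - f \<in> skew_cone M" "f - a \<in> skew_cone M"
      using cone_mono f m by blast+
    then show ?thesis using cone_add by fastforce
  qed
  with a(1) T(2) show ?thesis by blast
qed

text \<open>Here \<open>vs\<close> is a final segment of the order and the remaining coordinates are
  constant on \<open>T\<close>, the situation reached after some steps of
  \<open>iter_laurent\<close>. The earlier forms are then constant too, so
  \<open>0 \<le> skew N a v\<close> bounds \<open>a $ v\<close> from below.\<close>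

lemma iter_laurent_cone:
  fixes T :: "(real ^ 'n::{finite, linorder}) set"
  assumes "T \<subseteq> skew_cone N" "sorted vs"
    "\<And>a b j. a \<in> T \<Longrightarrow> b \<in> T \<Longrightarrow> j \<notin> set vs \<Longrightarrow> a $ j = b $ j"
    "\<And>j v. v \<in> set vs \<Longrightarrow> j \<notin> set vs \<Longrightarrow> j < v" "distinct vs"
  shows "iter_laurent vs T"
  using assms
proof (induction vs arbitrary: T)
  case (Cons v vs)
  have "bdd_below ((\<lambda>a. a $ v) ` T)"
  proof (cases "T = {}")
    case False
    then obtain b where b: "b \<in> T" by blast
    have "- real N * (\<Sum>j\<in>{..<v}. skew N b j) \<le> a $ v" if a: "a \<in> T" for a
    proof -
      have "skew N a j = skew N b j" if j: "j < v" for j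
      proof (rule skew_cong)
        fix k assume "k \<le> j"
        with j have "k < v" by simp
        then have "k \<notin> set (v # vs)" using Cons.prems(2) by auto
        then show "a $ k = b $ k" by (rule Cons.prems(3)[OF a b])
      qed
      then have "skew N a v = a $ v + real N * (\<Sum>j\<in>{..<v}. skew N b j)"
        by (simp add: skew.simps[of N a v])
      moreover have "0 \<le> skew N a v" using a Cons.prems(1) by (auto simp: skew_cone_def)
      ultimately show ?thesis by simp
    qed
    then show ?thesis by (intro bdd_belowI) auto
  qed simp
  moreover have "iter_laurent vs {a \<in> T. a $ v = c}" for c
  proof (rule Cons.IH)
    show "a $ j = b $ j" if "a \<in> {a \<in> T. a $ v = c}" "b \<in> {a \<in> T. a $ v = c}" "j \<notin> set vs" for a b j
      using Cons.prems(3)[of a b j] that by (cases "j = v") auto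
    show "j < w" if "w \<in> set vs" "j \<notin> set vs" for j w
      using Cons.prems(2,5) Cons.prems(4)[of w j] that by (cases "j = v") (auto simp: less_le)
  qed (use Cons.prems in auto)
  ultimately show ?case by simp
qed simp

lemma puiseux_support_cone: "p \<ge> 1 \<Longrightarrow> T \<subseteq> skew_cone N \<inter> exp_lattice p \<Longrightarrow> puiseux_support T"
  unfolding puiseux_support_def by (auto intro!: iter_laurent_cone[of T N])


section \<open>The ring of series supported in a cone\<close>

lemma iter_laurent_finite: "finite S \<Longrightarrow> iter_laurent vs S"
  by (induction vs arbitrary: S) auto

text \<open>For \<open>c\<close> outside \<open>rat_exp\<close> the monomial \<open>pmonom k c\<close> below is unspecified.\<close>

definition rat_exp :: "(real, 'n::finite) vec set" where
  "rat_exp = (\<Union>p\<in>{1..}. exp_lattice p)"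

lemma rat_expI: "p \<ge> 1 \<Longrightarrow> a \<in> exp_lattice p \<Longrightarrow> a \<in> rat_exp"
  by (auto simp: rat_exp_def)

lemma rat_expE:
  assumes "a \<in> rat_exp"
  obtains p where "p \<ge> 1" "a \<in> exp_lattice p"
  using assms by (auto simp: rat_exp_def)

lemma rat_exp_0 [simp]: "0 \<in> rat_exp"
  by (rule rat_expI[of 1]) (auto simp: exp_lattice_def)

lemma rat_exp_add:
  assumes "a \<in> rat_exp" "b \<in> rat_exp"
  shows "a + b \<in> rat_exp"
proof -
  obtain p q where pq: "p \<ge> 1" "a \<in> exp_lattice p" "q \<ge> 1" "b \<in> exp_lattice q"
    using assms by (metis rat_expE)
  have "a \<in> exp_lattice (p * q)" "b \<in> exp_lattice (p * q)"
    using exp_lattice_mono[of p "p * q"] exp_lattice_mono[of q "p * q"] pq by auto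
  then show ?thesis
    using pq by (intro rat_expI[of "p * q"] exp_lattice_add) auto
qed

lemma rat_exp_uminus: "a \<in> rat_exp \<Longrightarrow> - a \<in> rat_exp"
  by (auto simp: rat_exp_def exp_lattice_def)

lemma rat_exp_diff: "a \<in> rat_exp \<Longrightarrow> b \<in> rat_exp \<Longrightarrow> a - b \<in> rat_exp"
  using rat_exp_add[of a "- b"] rat_exp_uminus[of b] by simp

lemma rat_exp_scale_nat: "a \<in> rat_exp \<Longrightarrow> real k *\<^sub>R a \<in> rat_exp"
  by (induction k) (auto simp: scaleR_left_distrib intro: rat_exp_add)

lemma rat_exp_divide:
  assumes "a \<in> rat_exp" "k \<ge> 1"
  shows "(1 / real k) *\<^sub>R a \<in> rat_exp"
proof -
  obtain p where "p \<ge> 1" "a \<in> exp_lattice p" using assms(1) by (rule rat_expE)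
  with assms(2) show ?thesis
    by (intro rat_expI[of "p * k"]) (auto simp: exp_lattice_def)
qed

section \<open>Monomials with rational exponents\<close>

definition pmonom :: "'k::comm_ring_1 \<Rightarrow> (real, 'n) vec \<Rightarrow> ('k, 'n::{finite, linorder}) puiseux" where
  "pmonom k c = Abs_puiseux (\<lambda>a. if a = c then k else 0)"

lemma coeff_pmonom:
  assumes "c \<in> rat_exp"
  shows "puiseux_coeff (pmonom k c) = (\<lambda>a. if a = c then k else 0)"
proof -
  obtain p where "p \<ge> 1" "c \<in> exp_lattice p" using assms by (rule rat_expE)
  then have "puiseux_support {c}"
    by (auto simp: puiseux_support_def intro: iter_laurent_finite)
  then have "puiseux_support (supp (\<lambda>a. if a = c then k else 0))"
    by (rule puiseux_support_subset) (auto simp: supp_def)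
  then show ?thesis
    by (simp add: pmonom_def Abs_puiseux_inverse)
qed

lemma coeff_pmonom_mult:
  assumes "c \<in> rat_exp"
  shows "puiseux_coeff (pmonom k c * f) b = k * puiseux_coeff f (b - c)"
  unfolding times_puiseux.rep_eq
  by (subst conv_eq_sum[where X = "{(c, b - c)}"])
     (auto simp: coeff_pmonom[OF assms] mult_pairs_def supp_def split: if_splits)

lemma puiseux_eqI: "(\<And>a. puiseux_coeff f a = puiseux_coeff g a) \<Longrightarrow> f = g"
  by (simp add: puiseux_coeff_inject[symmetric] ext)

lemma pmonom_mult:
  assumes "c \<in> rat_exp" "d \<in> rat_exp"
  shows "pmonom k c * pmonom l d = pmonom (k * l) (c + d)"
  by (rule puiseux_eqI)
     (auto simp: coeff_pmonom_mult coeff_pmonom rat_exp_add assms algebra_simps)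

lemma pmonom_one: "pmonom 1 0 = 1"
  by (rule puiseux_eqI) (simp add: coeff_pmonom one_puiseux.rep_eq)

lemma pmonom_power:
  assumes "c \<in> rat_exp"
  shows "pmonom 1 c ^ k = pmonom 1 (real k *\<^sub>R c)"
  by (induction k) (auto simp: pmonom_one pmonom_mult assms rat_exp_scale_nat algebra_simps)

lemma puiseux_coeff_of_nat_mult: "puiseux_coeff (of_nat d * f) a = of_nat d * puiseux_coeff f a"
  by (induction d) (auto simp: distrib_right zero_puiseux.rep_eq plus_puiseux.rep_eq)

definition cone_series :: "nat \<Rightarrow> nat \<Rightarrow> ('k::comm_ring_1, 'n::{finite, linorder}) puiseux set" where
  "cone_series N p = {f. newton_diagram f \<subseteq> skew_cone N \<inter> exp_lattice p}"

text \<open>\<open>N\<close> may grow when a monomial is divided out, and \<open>p\<close> when a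
  slope is fractional, so neither is fixed.\<close>

definition cone_ring :: "('k::comm_ring_1, 'n::{finite, linorder}) puiseux set" where
  "cone_ring = (\<Union>N. \<Union>p\<in>{1..}. cone_series N p)"

lemma cone_ringI: "p \<ge> 1 \<Longrightarrow> f \<in> cone_series N p \<Longrightarrow> f \<in> cone_ring"
  by (auto simp: cone_ring_def)

lemma cone_series_mono: "N \<le> M \<Longrightarrow> p dvd q \<Longrightarrow> cone_series N p \<subseteq> cone_series M q"
  using cone_mono[of N M] exp_lattice_mono[of p q] unfolding cone_series_def by blast

text \<open>The families grow with \<open>N\<close> and, along divisibility, with \<open>p\<close>,
  so finitely many elements fit into one of them. This gives fixed data for Hensel's lemma and, in
  the end, one cone and one \<open>p\<close> for all roots.\<close>

lemma cone_series_common: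
  assumes "finite A" "A \<subseteq> cone_ring"
  obtains N p where "p \<ge> 1" "A \<subseteq> cone_series N p"
proof -
  from assms have "\<exists>N p. p \<ge> 1 \<and> A \<subseteq> cone_series N p"
  proof (induction A rule: finite_induct)
    case (insert f A)
    then obtain N p where Np: "p \<ge> 1" "A \<subseteq> cone_series N p" by blast
    obtain M q where Mq: "q \<ge> 1" "f \<in> cone_series M q"
      using insert.prems by (auto simp: cone_ring_def)
    have "insert f A \<subseteq> cone_series (max N M) (p * q)"
      using Np(2) Mq(2) cone_series_mono[of N "max N M" p "p * q"]
        cone_series_mono[of M "max N M" q "p * q"] by auto
    moreover have "p * q \<ge> 1" using Np(1) Mq(1) by simp
    ultimately show ?case by blast
  qed auto
  with that show ?thesis by blast
qed

lemma cone_ring_add: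
  assumes "f \<in> cone_ring" "g \<in> cone_ring"
  shows "f + g \<in> cone_ring"
proof -
  obtain N p where Np: "p \<ge> 1" "{f, g} \<subseteq> cone_series N p"
    using assms by (auto intro: cone_series_common[of "{f, g}"])
  have "newton_diagram (f + g) \<subseteq> newton_diagram f \<union> newton_diagram g"
    by (auto simp: newton_diagram_def supp_def plus_puiseux.rep_eq)
  with Np(2) have "f + g \<in> cone_series N p"
    unfolding cone_series_def by blast
  with Np(1) show ?thesis by (rule cone_ringI)
qed

lemma cone_ring_mult:
  assumes "f \<in> cone_ring" "g \<in> cone_ring"
  shows "f * g \<in> cone_ring"
proof -
  obtain N p where Np: "p \<ge> 1" "{f, g} \<subseteq> cone_series N p"
    using assms by (auto intro: cone_series_common[of "{f, g}"])
  have "newton_diagram (f * g) \<subseteq> setsum (newton_diagram f) (newton_diagram g)"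
    using supp_conv by (simp add: newton_diagram_def times_puiseux.rep_eq)
  with Np(2) have "f * g \<in> cone_series N p"
    unfolding cone_series_def by (fastforce elim!: setsumE intro: cone_add exp_lattice_add)
  with Np(1) show ?thesis by (rule cone_ringI)
qed

lemma cone_ring_pmonom:
  assumes "c \<in> rat_exp" "c \<in> lexnn"
  shows "pmonom k c \<in> cone_ring"
proof -
  obtain p where "p \<ge> 1" "c \<in> exp_lattice p" using assms(1) by (rule rat_expE)
  moreover obtain N where "c \<in> skew_cone N" using assms(2) by (auto simp: lexnn_def)
  ultimately show ?thesis
    by (intro cone_ringI[of p _ N])
       (auto simp: cone_series_def newton_diagram_def supp_def coeff_pmonom assms(1) split: if_splits)
qed

lemma lexnn_0 [simp]: "0 \<in> lexnn"
  by (auto simp: lexnn_def)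

lemma cone_ring_1 [simp]: "1 \<in> cone_ring"
  using cone_ring_pmonom[of 0 1] by (simp add: pmonom_one)

lemma cone_ring_0 [simp]: "0 \<in> cone_ring"
  by (rule cone_ringI[of 1 _ 0]) (auto simp: cone_series_def newton_diagram_def supp_def zero_puiseux.rep_eq)

text \<open>The valuation of \<open>f\<close>: \<open>v\<close> is the exponent given by
  \<open>cone_lattice_minimum\<close>, and dividing by its monomial leaves a series whose constant
  term is the non-zero coefficient at \<open>v\<close>.\<close>

lemma cone_ring_minimum:
  assumes "f \<in> cone_ring" "f \<noteq> 0"
  obtains v where "v \<in> rat_exp" "v \<in> lexnn" "puiseux_coeff f v \<noteq> 0" "pmonom 1 (- v) * f \<in> cone_ring"
proof -
  obtain N p where Np: "p \<ge> 1" "newton_diagram f \<subseteq> skew_cone N \<inter> exp_lattice p"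
    using assms(1) by (auto simp: cone_ring_def cone_series_def)
  have "newton_diagram f \<noteq> {}"
    using assms(2) puiseux_eqI[of f 0] by (auto simp: newton_diagram_def supp_def zero_puiseux.rep_eq)
  from cone_lattice_minimum[OF Np this] obtain v M where
    v: "v \<in> newton_diagram f" "\<And>b. b \<in> newton_diagram f \<Longrightarrow> b - v \<in> skew_cone M" by blast
  have vr: "v \<in> rat_exp" using v(1) Np by (auto intro: rat_expI)
  have "pmonom 1 (- v) * f \<in> cone_series M p"
  proof -
    have "b \<in> skew_cone M \<inter> exp_lattice p" if "b + v \<in> newton_diagram f" for b
    proof
      show "b \<in> skew_cone M" using v(2)[OF that] by simp
      have "real p * b $ j \<in> \<int>" for j
      proof -
        have "real p * (b + v) $ j \<in> \<int>" "real p * v $ j \<in> \<int>"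
          using that v(1) Np(2) unfolding exp_lattice_def by blast+
        then have "real p * (b + v) $ j - real p * v $ j \<in> \<int>" by (rule Ints_diff)
        then show ?thesis by (simp add: algebra_simps)
      qed
      then show "b \<in> exp_lattice p" by (simp add: exp_lattice_def)
    qed
    then show ?thesis
      by (auto simp: cone_series_def newton_diagram_def supp_def coeff_pmonom_mult rat_exp_uminus vr)
  qed
  then have "pmonom 1 (- v) * f \<in> cone_ring" using Np(1) by (rule cone_ringI[rotated])
  then show ?thesis
    using that[of v] v(1) vr Np(2) by (auto simp: newton_diagram_def supp_def lexnn_def)
qed

text \<open>The smallest slope of the Newton polygon. With \<open>v i\<close> a minimal exponent of
  the coefficient of index \<open>i\<close>, the slope \<open>c\<close> is the lexicographic minimum
  \<open>w k\<close> of the quotients \<open>w i\<close>; at the index \<open>k\<close> it is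
  attained, which gives the last claim.\<close>

lemma newton_slope:
  fixes P :: "('k::comm_ring_1, 'n::{finite, linorder}) puiseux poly"
  assumes "\<And>i. coeff P i \<in> cone_ring" "i1 < d" "coeff P i1 \<noteq> 0"
  obtains c where "c \<in> rat_exp" "c \<in> lexnn"
    "\<And>i. i < d \<Longrightarrow> pmonom 1 (- (real (d - i) *\<^sub>R c)) * coeff P i \<in> cone_ring"
    "\<exists>i<d. puiseux_coeff (coeff P i) (real (d - i) *\<^sub>R c) \<noteq> 0"
proof -
  let ?I = "{i. i < d \<and> coeff P i \<noteq> 0}"
  have "\<exists>v. v \<in> rat_exp \<and> v \<in> lexnn \<and> puiseux_coeff (coeff P i) v \<noteq> 0 \<and>
      pmonom 1 (- v) * coeff P i \<in> cone_ring" if "i \<in> ?I" for i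
    using that by (auto intro: cone_ring_minimum[OF assms(1)[of i]])
  then have "\<forall>i\<in>?I. \<exists>v. v \<in> rat_exp \<and> v \<in> lexnn \<and> puiseux_coeff (coeff P i) v \<noteq> 0 \<and>
      pmonom 1 (- v) * coeff P i \<in> cone_ring" by blast
  then obtain v0 where v0: "\<forall>i\<in>?I. v0 i \<in> rat_exp \<and> v0 i \<in> lexnn \<and> puiseux_coeff (coeff P i) (v0 i) \<noteq> 0 \<and>
      pmonom 1 (- v0 i) * coeff P i \<in> cone_ring" by (rule bchoice[THEN exE])
  obtain v where v: "\<And>i. i \<in> ?I \<Longrightarrow> v i \<in> rat_exp" "\<And>i. i \<in> ?I \<Longrightarrow> v i \<in> lexnn"
    "\<And>i. i \<in> ?I \<Longrightarrow> puiseux_coeff (coeff P i) (v i) \<noteq> 0"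
    "\<And>i. i \<in> ?I \<Longrightarrow> pmonom 1 (- v i) * coeff P i \<in> cone_ring"
    using v0 by (intro that[of v0]) blast+
  define w where "w i = (1 / real (d - i)) *\<^sub>R v i" for i
  have vw: "v i = real (d - i) *\<^sub>R w i" if "i \<in> ?I" for i
    using that by (simp add: w_def)
  have "finite ?I" "?I \<noteq> {}" using assms(2,3) by auto
  from lexnn_minimum[OF this] obtain k where k: "k \<in> ?I" "\<And>i. i \<in> ?I \<Longrightarrow> w i - w k \<in> lexnn" by blast
  have wr: "w i \<in> rat_exp" if "i \<in> ?I" for i
    unfolding w_def using v(1)[OF that] that by (intro rat_exp_divide) auto
  show ?thesis
  proof (rule that[of "w k"])
    show "w k \<in> rat_exp" by (rule wr[OF k(1)])
    show "w k \<in> lexnn" unfolding w_def using v(2)[OF k(1)] by (intro lexnn_scaleR) auto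
    show "\<exists>i<d. puiseux_coeff (coeff P i) (real (d - i) *\<^sub>R w k) \<noteq> 0"
      using v(3)[OF k(1)] k(1) unfolding vw[OF k(1)] by blast
    show "pmonom 1 (- (real (d - i) *\<^sub>R w k)) * coeff P i \<in> cone_ring" if "i < d" for i
    proof (cases "coeff P i = 0")
      case False
      with that have i: "i \<in> ?I" by simp
      \<comment> \<open>By minimality of \<open>w k\<close> the excess of \<open>v i\<close> over
        \<open>real (d - i) *\<^sub>R w k\<close> is lexicographically non-negative, so its monomial
        lies in \<open>cone_ring\<close>.\<close>
      let ?e = "real (d - i) *\<^sub>R (w i - w k)"
      have e: "?e \<in> rat_exp" "?e \<in> lexnn"
        by (intro rat_exp_scale_nat rat_exp_diff lexnn_scaleR wr k i of_nat_0_le_iff)+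
      have "pmonom 1 (- (real (d - i) *\<^sub>R w k)) = pmonom 1 ?e * (pmonom 1 (- v i) :: ('k, 'n) puiseux)"
        using e(1) v(1)[OF i] vw[OF i] by (simp add: pmonom_mult rat_exp_uminus scaleR_diff_right del: of_nat_diff)
      then have "pmonom 1 (- (real (d - i) *\<^sub>R w k)) * coeff P i =
          pmonom 1 ?e * (pmonom 1 (- v i) * coeff P i)" by (simp only: mult.assoc)
      then show ?thesis
        using cone_ring_mult[OF cone_ring_pmonom[OF e] v(4)[OF i]] by simp
    qed simp
  qed
qed


section \<open>Hensel's lemma\<close>

text \<open>Modulo \<open>L = [:- \<alpha>, 1:]\<close> the polynomial \<open>B\<close> is the unit
  \<open>poly B \<alpha>\<close>, which gives \<open>b * B - b * L * Q = 1\<close>. Multiplying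
  \<open>b * L * Q\<close> by the identity for the exponent \<open>r\<close> raises that exponent by
  one.\<close>

lemma bezout_linear_power:
  fixes B :: "'a::field poly"
  assumes "poly B \<alpha> \<noteq> 0"
  shows "\<exists>U V. U * [:- \<alpha>, 1:] ^ r + V * B = 1"
proof (induction r)
  case 0
  then show ?case by (intro exI[of _ 1] exI[of _ 0]) simp
next
  case (Suc r)
  define L where "L = [:- \<alpha>, 1:]"
  define b where "b = [:1 / poly B \<alpha>:]"
  obtain U V where UV: "U * L ^ r + V * B = 1" using Suc unfolding L_def by blast
  have "poly (B - [:poly B \<alpha>:]) \<alpha> = 0" by simp
  then obtain Q where Q: "B - [:poly B \<alpha>:] = L * Q"
    unfolding poly_eq_0_iff_dvd L_def by (rule dvdE)
  have "b * [:poly B \<alpha>:] = 1" using assms by (simp add: b_def one_pCons)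
  moreover have "[:poly B \<alpha>:] = B - L * Q" using Q by (simp add: algebra_simps)
  ultimately have 1: "b * B - b * L * Q = 1" by (simp add: algebra_simps)
  have "(- b * Q * U) * L ^ Suc r + (b - b * Q * L * V) * B
      = b * B - b * L * Q * (U * L ^ r + V * B)"
    by (simp add: algebra_simps)
  also have "\<dots> = 1" unfolding UV using 1 by simp
  finally show ?case unfolding L_def by blast
qed

text \<open>The linear equation solved in every step of Hensel's lemma. Reducing
  \<open>E * V\<close> modulo \<open>A\<close> makes \<open>u\<close> small; the bound on
  \<open>v\<close> follows by comparing degrees in \<open>A * v = E - u * B\<close>.\<close>

lemma bezout_degree:
  fixes A B :: "'a::field poly"
  assumes "U * A + V * B = 1" "degree A > 0" "degree B > 0" "degree E < degree A + degree B"
  shows "\<exists>u v. u * B + A * v = E \<and> degree u < degree A \<and> degree v < degree B"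
proof -
  define u where "u = (E * V) mod A"
  define q where "q = E * V div A"
  define v where "v = E * U + q * B"
  have u: "u = E * V - q * A" by (simp add: u_def q_def minus_div_mult_eq_mod)
  have "u * B + A * v = E * (U * A + V * B)"
    unfolding u v_def by (simp add: algebra_simps)
  then have eq: "u * B + A * v = E" by (simp add: assms(1))
  have "A \<noteq> 0" "B \<noteq> 0" using assms(2,3) by auto
  have u: "degree u < degree A"
    using degree_mod_less[OF \<open>A \<noteq> 0\<close>, of "E * V"] assms(2) by (auto simp: u_def)
  have "degree v < degree B"
  proof (cases "v = 0")
    case False
    have "degree (u * B) < degree A + degree B"
      using degree_mult_le[of u B] u by linarith
    with assms(4) have "degree (E - u * B) < degree A + degree B" by (rule degree_diff_less)
    moreover have "E - u * B = A * v" using eq by (simp add: algebra_simps)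
    ultimately show ?thesis using False \<open>A \<noteq> 0\<close> by (simp add: degree_mult_eq)
  qed (use assms(3) in simp)
  with u eq show ?thesis by blast
qed

text \<open>On lattice points of the cone, where the floor is exact, this is an additive grading by
  natural numbers that vanishes only at \<open>0\<close>.\<close>

definition height :: "nat \<Rightarrow> nat \<Rightarrow> (real, 'n::{finite, linorder}) vec \<Rightarrow> nat" where
  "height N p a = (\<Sum>i\<in>UNIV. nat \<lfloor>real p * skew N a i\<rfloor>)"

lemma real_height:
  assumes "a \<in> skew_cone N" "a \<in> exp_lattice p"
  shows "real (height N p a) = real p * (\<Sum>i\<in>UNIV. skew N a i)"
  by (simp only: height_def of_nat_sum cone_lattice_nat[OF assms] sum_distrib_left)

lemma height_add:
  assumes "a \<in> skew_cone N \<inter> exp_lattice p" "b \<in> skew_cone N \<inter> exp_lattice p"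
  shows "height N p (a + b) = height N p a + height N p b"
proof -
  have "real (height N p (a + b)) = real (height N p a) + real (height N p b)"
    using assms by (simp add: real_height cone_add exp_lattice_add skew_add sum.distrib distrib_left)
  then show ?thesis by linarith
qed

lemma height_pos:
  assumes "a \<in> skew_cone N \<inter> exp_lattice p" "p \<ge> 1" "a \<noteq> 0"
  shows "height N p a > 0"
proof (rule ccontr)
  assume "\<not> height N p a > 0"
  then have "real p * (\<Sum>i\<in>UNIV. skew N a i) = 0"
    using assms(1) by (simp flip: real_height)
  then have "(\<Sum>i\<in>UNIV. skew N a i) = 0" using assms(2) by simp
  then have "\<forall>i\<in>UNIV. skew N a i = 0"
    using assms(1) by (subst (asm) sum_nonneg_eq_0_iff) (auto simp: skew_cone_def)
  then have "a = 0" by (intro skew_eq_0) auto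
  with assms(3) show False by contradiction
qed

lemma finite_mult_pairs_cone: "p \<ge> 1 \<Longrightarrow>
    finite (mult_pairs (skew_cone N \<inter> exp_lattice p) (skew_cone N \<inter> exp_lattice p) c)"
  by (intro fin_pairsD fin_pairs_puiseux puiseux_support_cone[of p _ N]) auto

text \<open>
  A series in \<open>z\<close> and the \<open>x\<^sub>j\<close> is represented by the polynomials in \<open>z\<close> that are its
  coefficients at the exponents \<open>a\<close>; the factors are constructed by recursion on \<open>height N p a\<close>.
\<close>

lemma hensel_family:
  fixes F :: "(real, 'n::{finite, linorder}) vec \<Rightarrow> 'k::field poly"
  defines "X \<equiv> \<lambda>N p. skew_cone N \<inter> exp_lattice p :: (real, 'n) vec set"
  assumes p: "p \<ge> 1" and F0: "F 0 = A0 * B0"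
    and Fdeg: "\<And>a. a \<noteq> 0 \<Longrightarrow> degree (F a) < degree A0 + degree B0"
    and bez: "U * A0 + V * B0 = 1" and pos: "degree A0 > 0" "degree B0 > 0"
  shows "\<exists>A B. A 0 = A0 \<and> B 0 = B0 \<and>
    (\<forall>a. a \<noteq> 0 \<longrightarrow> degree (A a) < degree A0 \<and> degree (B a) < degree B0) \<and>
    (\<forall>c\<in>X N p. F c = (\<Sum>(a, b)\<in>mult_pairs (X N p) (X N p) c. A a * B b))"
proof -
  let ?X = "X N p" and ?h = "height N p"
  let ?M = "\<lambda>c. {(a, b) \<in> mult_pairs ?X ?X c. a \<noteq> 0 \<and> b \<noteq> 0}"
  let ?S = "\<lambda>f c. \<Sum>(a, b)\<in>?M c. fst (f a) * snd (f b)"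
  \<comment> \<open>\<open>Q f c r\<close> says that \<open>r\<close> is an admissible pair of
    coefficients at \<open>c\<close>, given \<open>f\<close> at smaller heights. The sum
    \<open>?S\<close> leaves out the pairs with a component \<open>0\<close>, so the equation is
    linear in \<open>r\<close>.\<close>
  define Q where "Q f c r \<longleftrightarrow> (if c = 0 then r = (A0, B0)
    else degree (fst r) < degree A0 \<and> degree (snd r) < degree B0 \<and>
      (c \<in> ?X \<longrightarrow> fst r * B0 + A0 * snd r = F c - ?S f c))"
    for f :: "(real, 'n) vec \<Rightarrow> 'k poly \<times> 'k poly" and c r
  have less: "?h a < ?h c \<and> ?h b < ?h c" if "(a, b) \<in> ?M c" for a b c
    using that height_add[of a N p b] height_pos[of a N p] height_pos[of b N p] p
    by (auto simp: mult_pairs_def X_def)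
  have "\<exists>f. \<forall>c. Q f c (f c)"
  proof (rule dependent_wf_choice)
    show "wf (Wellfounded.measure ?h)" by simp
    fix f g :: "(real, 'n) vec \<Rightarrow> 'k poly \<times> 'k poly" and c r
    assume "\<And>z. (z, c) \<in> Wellfounded.measure ?h \<Longrightarrow> f z = g z"
    \<comment> \<open>\<open>Q\<close> sees \<open>f\<close> only at exponents of smaller height, as
      the choice principle requires.\<close>
    then have "?S f c = ?S g c"
    proof (intro sum.cong refl)
      fix x assume x: "x \<in> ?M c"
      obtain a b where ab: "x = (a, b)" by (cases x)
      have "f a = g a" "f b = g b"
        using less[of a b c] x unfolding ab by (auto intro!: \<open>\<And>z. (z, c) \<in> _ \<Longrightarrow> f z = g z\<close>)
      then show "(case x of (a, b) \<Rightarrow> fst (f a) * snd (f b)) = (case x of (a, b) \<Rightarrow> fst (g a) * snd (g b))"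
        by (simp add: ab)
    qed
    then show "Q f c r = Q g c r" by (simp add: Q_def)
  next
    fix c and f :: "(real, 'n) vec \<Rightarrow> 'k poly \<times> 'k poly"
    assume IH: "\<And>y. (y, c) \<in> Wellfounded.measure ?h \<Longrightarrow> Q f y (f y)"
    show "\<exists>r. Q f c r"
    proof (cases "c \<noteq> 0")
      case True
      have "degree (fst (f a) * snd (f b)) < degree A0 + degree B0" if "(a, b) \<in> ?M c" for a b
      proof -
        have "Q f a (f a)" "Q f b (f b)" using less[OF that] IH by simp_all
        then have "degree (fst (f a)) < degree A0" "degree (snd (f b)) < degree B0"
          using that by (auto simp: Q_def split: if_splits)
        then show ?thesis using degree_mult_le[of "fst (f a)" "snd (f b)"] by linarith
      qed
      then have "degree (?S f c) < degree A0 + degree B0"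
        using pos by (intro degree_sum_less) (auto simp del: mem_Collect_eq)
      then have "degree (F c - ?S f c) < degree A0 + degree B0"
        using Fdeg[OF True] by (intro degree_diff_less)
      from bezout_degree[OF bez pos this] obtain u v where
        "u * B0 + A0 * v = F c - ?S f c" "degree u < degree A0" "degree v < degree B0" by blast
      with True have "Q f c (u, v)" by (simp add: Q_def)
      then show ?thesis by blast
    qed (simp add: Q_def)
  qed
  then obtain f where f: "\<And>c. Q f c (f c)" by blast
  have f0: "f 0 = (A0, B0)" using f[of 0] by (simp add: Q_def)
  have "F c = (\<Sum>(a, b)\<in>mult_pairs ?X ?X c. fst (f a) * snd (f b))" if c: "c \<in> ?X" for c
  proof (cases "c = 0")
    case True
    \<comment> \<open>Heights are additive, so two exponents with sum \<open>0\<close> both have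
      height \<open>0\<close>.\<close>
    have "mult_pairs ?X ?X 0 = {(0, 0)}"
    proof -
      have "a = 0 \<and> b = 0" if "a \<in> ?X" "b \<in> ?X" "a + b = 0" for a b
      proof -
        have "height N p (0 :: (real, 'n) vec) = 0" by (simp add: height_def)
        then have "height N p a = 0" "height N p b = 0"
          using that height_add[of a N p b] by (simp_all add: X_def)
        then show ?thesis
          using that(1,2) height_pos[of a N p] height_pos[of b N p] p unfolding X_def by auto
      qed
      then show ?thesis by (auto simp: mult_pairs_def X_def exp_lattice_def)
    qed
    with True show ?thesis by (simp add: f0 F0)
  next
    case False
    have "0 \<in> ?X" by (simp add: X_def exp_lattice_def)
    \<comment> \<open>The two pairs with a component \<open>0\<close> contribute the terms that
      contain the unknowns at \<open>c\<close>.\<close>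
    then have eq: "mult_pairs ?X ?X c = insert (0, c) (insert (c, 0) (?M c))"
      using c by (auto simp: mult_pairs_def)
    have fin: "finite (?M c)"
      by (rule finite_subset[OF _ finite_mult_pairs_cone[OF p, of N c]]) (auto simp: X_def)
    have "(\<Sum>(a, b)\<in>mult_pairs ?X ?X c. fst (f a) * snd (f b)) =
        (\<Sum>(a, b)\<in>insert (0, c) (insert (c, 0) (?M c)). fst (f a) * snd (f b))"
      by (rule sum.cong[OF eq refl])
    also have "\<dots> = A0 * snd (f c) + (fst (f c) * B0 + ?S f c)"
      using False fin by (subst sum.insert; simp add: f0)
    also have "\<dots> = F c" using f[of c] c False by (simp add: Q_def algebra_simps)
    finally show ?thesis by simp
  qed
  moreover have "degree (fst (f a)) < degree A0 \<and> degree (snd (f a)) < degree B0" if "a \<noteq> 0" for a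
    using f[of a] that by (simp add: Q_def)
  ultimately show ?thesis
    using f0 by (intro exI[of _ "\<lambda>a. fst (f a)"] exI[of _ "\<lambda>a. snd (f a)"]) auto
qed

text \<open>Transposition: polynomials in \<open>z\<close> indexed by exponents become one
  polynomial in \<open>z\<close> with series as coefficients. No degree exceeds that of
  \<open>A 0\<close>, so \<open>Abs_poly\<close> applies; only \<open>A 0\<close> reaches the top
  degree, so the result is monic.\<close>

lemma family_imp_poly:
  fixes A :: "(real, 'n::{finite, linorder}) vec \<Rightarrow> 'k::field poly"
  assumes "p \<ge> 1" "lead_coeff (A 0) = 1" "\<And>a. a \<noteq> 0 \<Longrightarrow> degree (A a) < degree (A 0)"
  obtains P :: "('k, 'n) puiseux poly" where "lead_coeff P = 1" "degree P = degree (A 0)"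
    "\<And>i. coeff P i \<in> cone_series N p"
    "\<And>i a. a \<in> skew_cone N \<inter> exp_lattice p \<Longrightarrow> puiseux_coeff (coeff P i) a = coeff (A a) i"
proof -
  let ?X = "skew_cone N \<inter> exp_lattice p" and ?d = "degree (A 0)"
  define g where "g i = Abs_puiseux (\<lambda>a. if a \<in> ?X then coeff (A a) i else 0)" for i
  have g: "puiseux_coeff (g i) = (\<lambda>a. if a \<in> ?X then coeff (A a) i else 0)" for i
  proof -
    have "puiseux_support (supp (\<lambda>a. if a \<in> ?X then coeff (A a) i else 0))"
      by (rule puiseux_support_cone[OF assms(1), of _ N]) (auto simp: supp_def split: if_splits)
    then show ?thesis by (simp add: g_def Abs_puiseux_inverse)
  qed
  have z: "(0 :: (real, 'n) vec) \<in> ?X" by (simp add: exp_lattice_def)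
  have high: "g i = 0" if "i > ?d" for i
  proof (rule puiseux_eqI)
    fix a
    have "degree (A a) \<le> ?d" using assms(3)[of a] by (cases "a = 0") auto
    with that show "puiseux_coeff (g i) a = puiseux_coeff 0 a"
      by (simp add: g zero_puiseux.rep_eq coeff_eq_0)
  qed
  have top: "g ?d = 1"
  proof (rule puiseux_eqI)
    fix a
    show "puiseux_coeff (g ?d) a = puiseux_coeff 1 a"
      using assms(2) assms(3)[of a] z by (simp add: g one_puiseux.rep_eq coeff_eq_0)
  qed
  define P where "P = Abs_poly g"
  have P: "coeff P = g" unfolding P_def by (rule coeff_Abs_poly[of ?d]) (rule high)
  have deg: "degree P = ?d"
    by (rule antisym) (auto intro: degree_le le_degree simp: P high top)
  show ?thesis
    by (rule that[of P])
       (auto simp: deg P top g cone_series_def newton_diagram_def supp_def split: if_splits)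
qed

text \<open>Comparing the polynomials in \<open>z\<close> at each exponent reduces this to
  \<open>hensel_family\<close>; the factors keep the same \<open>N\<close> and
  \<open>p\<close>.\<close>

lemma hensel:
  fixes P :: "('k::field, 'n::{finite, linorder}) puiseux poly"
  assumes p: "p \<ge> 1" and P: "\<And>i. coeff P i \<in> cone_series N p" "lead_coeff P = 1"
    and res: "map_poly (\<lambda>h. puiseux_coeff h 0) P = A0 * B0"
    and AB0: "lead_coeff A0 = 1" "lead_coeff B0 = 1" "degree A0 > 0" "degree B0 > 0"
    and bez: "U * A0 + V * B0 = 1"
  obtains A B where "P = A * B" "lead_coeff A = 1" "lead_coeff B = 1"
    "degree A = degree A0" "degree B = degree B0"
    "\<And>i. coeff A i \<in> cone_series N p" "\<And>i. coeff B i \<in> cone_series N p"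
proof -
  let ?X = "skew_cone N \<inter> exp_lattice p :: (real, 'n) vec set"
  define F where "F a = map_poly (\<lambda>h. puiseux_coeff h a) P" for a
  have F: "coeff (F a) i = puiseux_coeff (coeff P i) a" for a i
    by (simp add: F_def coeff_map_poly zero_puiseux.rep_eq)
  \<comment> \<open>As \<open>P\<close> is monic, its leading coefficient contributes only at the
    exponent \<open>0\<close>.\<close>
  have F_top: "coeff (F a) i = 0" if "i > degree P \<or> i = degree P \<and> a \<noteq> 0" for i a
    using that P(2) by (auto simp: F coeff_eq_0 zero_puiseux.rep_eq one_puiseux.rep_eq)
  have F0: "F 0 = A0 * B0" using res by (simp add: F_def)
  have "coeff (F 0) (degree P) = 1" by (simp add: F P(2) one_puiseux.rep_eq)
  then have "degree (F 0) = degree P"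
    by (intro antisym degree_le le_degree) (auto simp: F_top)
  moreover have "degree (F 0) = degree A0 + degree B0"
    unfolding F0 using AB0(3,4) by (intro degree_mult_eq) auto
  ultimately have dP: "degree P = degree A0 + degree B0" by simp
  have Fdeg: "degree (F a) < degree A0 + degree B0" if "a \<noteq> 0" for a
  proof -
    have "degree (F a) \<le> degree A0 + degree B0 - 1"
      using that by (intro degree_le allI impI F_top) (auto simp: dP)
    with AB0(3) show ?thesis by linarith
  qed
  obtain A' B' where AB': "A' 0 = A0" "B' 0 = B0"
    "\<And>a. a \<noteq> 0 \<Longrightarrow> degree (A' a) < degree A0 \<and> degree (B' a) < degree B0"
    "\<And>c. c \<in> ?X \<Longrightarrow> F c = (\<Sum>(a, b)\<in>mult_pairs ?X ?X c. A' a * B' b)"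
    using hensel_family[where F = F and N = N, OF p F0 Fdeg bez AB0(3,4)] by blast
  obtain A :: "('k, 'n) puiseux poly" where A: "lead_coeff A = 1" "degree A = degree A0"
    "\<And>i. coeff A i \<in> cone_series N p"
    "\<And>i a. a \<in> ?X \<Longrightarrow> puiseux_coeff (coeff A i) a = coeff (A' a) i"
    using family_imp_poly[OF p, of A' N] AB' AB0 by auto
  obtain B :: "('k, 'n) puiseux poly" where B: "lead_coeff B = 1" "degree B = degree B0"
    "\<And>i. coeff B i \<in> cone_series N p"
    "\<And>i a. a \<in> ?X \<Longrightarrow> puiseux_coeff (coeff B i) a = coeff (B' a) i"
    using family_imp_poly[OF p, of B' N] AB' AB0 by auto
  \<comment> \<open>Summing over \<open>?X\<close> instead of the supports gives all products the
    same index set, so that the sums over exponents and over powers of \<open>z\<close> can be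
    exchanged.\<close>
  have conv: "puiseux_coeff (f * g) c =
      (\<Sum>(a, b)\<in>mult_pairs ?X ?X c. puiseux_coeff f a * puiseux_coeff g b)"
    if "f \<in> cone_series N p" "g \<in> cone_series N p" for f g :: "('k, 'n) puiseux" and c
    unfolding times_puiseux.rep_eq
  proof (rule conv_eq_sum)
    show "mult_pairs (supp (puiseux_coeff f)) (supp (puiseux_coeff g)) c \<subseteq> mult_pairs ?X ?X c"
      using that by (auto simp: mult_pairs_def cone_series_def newton_diagram_def)
  qed (use finite_mult_pairs_cone[OF p, of N c] in \<open>auto simp: mult_pairs_def\<close>)
  have "coeff P i = coeff (A * B) i" for i
  proof (rule puiseux_eqI)
    fix c
    have sum_coeff: "puiseux_coeff (\<Sum>j\<in>J. f j) c = (\<Sum>j\<in>J. puiseux_coeff (f j) c)"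
      if "finite J" for J :: "nat set" and f :: "nat \<Rightarrow> ('k, 'n) puiseux"
      using that by (induction J rule: finite_induct)
        (auto simp: zero_puiseux.rep_eq plus_puiseux.rep_eq)
    have "puiseux_coeff (coeff (A * B) i) c = (\<Sum>j\<le>i. puiseux_coeff (coeff A j * coeff B (i - j)) c)"
      by (simp add: coeff_mult sum_coeff)
    also have "\<dots> = (\<Sum>j\<le>i. \<Sum>(a, b)\<in>mult_pairs ?X ?X c. coeff (A' a) j * coeff (B' b) (i - j))"
      unfolding conv[OF A(3) B(3)]
      by (intro sum.cong refl) (auto simp: mult_pairs_def A(4) B(4))
    also have "\<dots> = (\<Sum>(a, b)\<in>mult_pairs ?X ?X c. coeff (A' a * B' b) i)"
      by (subst sum.swap) (simp add: coeff_mult case_prod_beta)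
    also have "\<dots> = puiseux_coeff (coeff P i) c"
    proof (cases "c \<in> ?X")
      case True
      have "puiseux_coeff (coeff P i) c = coeff (F c) i" by (simp add: F)
      also have "\<dots> = (\<Sum>(a, b)\<in>mult_pairs ?X ?X c. coeff (A' a * B' b) i)"
        by (simp add: AB'(4)[OF True] coeff_sum case_prod_beta)
      finally show ?thesis by simp
    next
      case False
      then have "mult_pairs ?X ?X c = {}"
        by (auto simp: mult_pairs_def intro: cone_add exp_lattice_add)
      moreover have "puiseux_coeff (coeff P i) c = 0"
        using False P(1)[of i] by (auto simp: cone_series_def newton_diagram_def supp_def)
      ultimately show ?thesis by simp
    qed
    finally show "puiseux_coeff (coeff P i) c = puiseux_coeff (coeff (A * B) i) c" by simp
  qed
  then have "P = A * B" by (simp add: poly_eq_iff)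
  with A B show ?thesis by (intro that[of A B])
qed



section \<open>Splitting of monic polynomials\<close>

text \<open>For removing the coefficient of index \<open>d - 1\<close> by a translation. A bound
  \<open>d\<close> in place of the degree lets the induction pass from \<open>d\<close> to its
  predecessor.\<close>

lemma coeff_pcompose_shift:
  fixes P :: "'a::comm_ring_1 poly"
  assumes "degree P \<le> d"
  shows "(\<forall>j>d. coeff (pcompose P [:b, 1:]) j = 0) \<and> coeff (pcompose P [:b, 1:]) d = coeff P d \<and>
    (d > 0 \<longrightarrow> coeff (pcompose P [:b, 1:]) (d - 1) = coeff P (d - 1) + of_nat d * b * coeff P d)"
  using assms
proof (induction P arbitrary: d)
  case (pCons a P)
  have shift: "coeff (pcompose (pCons a P) [:b, 1:]) (Suc j) =
      b * coeff (pcompose P [:b, 1:]) (Suc j) + coeff (pcompose P [:b, 1:]) j" for j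
    by (simp add: pcompose_pCons)
  show ?case
  proof (cases d)
    case 0
    with pCons.prems have "P = 0" by (auto split: if_splits)
    with 0 show ?thesis by (simp add: coeff_pCons split: nat.splits)
  next
    case (Suc e)
    have "degree P \<le> e" using pCons.prems Suc by (auto split: if_splits)
    note IH = pCons.IH[OF this]
    have "coeff (pcompose (pCons a P) [:b, 1:]) j = 0" if "j > d" for j
      using IH that Suc by (cases j) (auto simp: shift)
    moreover have "coeff (pcompose (pCons a P) [:b, 1:]) d = coeff (pCons a P) d"
      using IH by (simp add: shift Suc)
    moreover have "coeff (pcompose (pCons a P) [:b, 1:]) e = coeff (pCons a P) e + of_nat d * b * coeff P e"
    proof (cases e)
      case 0
      then show ?thesis using IH Suc by (simp add: pcompose_pCons)
    next
      case (Suc f)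
      then show ?thesis using IH \<open>d = Suc e\<close> by (simp add: shift algebra_simps)
    qed
    ultimately show ?thesis by (simp add: Suc)
  qed
qed simp

lemma prod_list_pcompose:
  fixes xs :: "'a::comm_ring_1 list"
  shows "pcompose (\<Prod>x\<leftarrow>xs. [:- x, 1:]) q = (\<Prod>x\<leftarrow>xs. pcompose [:- x, 1:] q)"
  by (induction xs) (simp_all add: pcompose_1 pcompose_mult del: mult_pCons_left)

text \<open>\<open>Y\<close> is the inverse of \<open>X\<close>, so each factor
  \<open>Y * z - x\<close> times \<open>X\<close> is \<open>z - X * x\<close>. This carries roots
  back through a scaling of \<open>z\<close>.\<close>

lemma prod_list_scale:
  fixes X :: "'a::comm_ring_1"
  assumes "X * Y = 1"
  shows "smult (X ^ length xs) (pcompose (\<Prod>x\<leftarrow>xs. [:- x, 1:]) [:0, Y:]) = (\<Prod>x\<leftarrow>xs. [:- (X * x), 1:])"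
proof (induction xs)
  case (Cons x xs)
  have "smult X (pcompose [:- x, 1:] [:0, Y:]) = [:- (X * x), 1:]"
    using assms by (simp add: pcompose_pCons)
  moreover have "smult (a * b) (p * q) = smult a p * smult b q" for a b :: 'a and p q
    by (simp add: mult.commute)
  ultimately have "smult (X ^ length (x # xs)) (pcompose (\<Prod>x\<leftarrow>x # xs. [:- x, 1:]) [:0, Y:]) =
      [:- (X * x), 1:] * smult (X ^ length xs) (pcompose (\<Prod>x\<leftarrow>xs. [:- x, 1:]) [:0, Y:])"
    by (simp only: list.map prod_list.Cons pcompose_mult length_Cons power_Suc)
  with Cons show ?case by (simp del: mult_pCons_left)
qed (simp add: pcompose_1)

text \<open>Split off the full power of one root \<open>\<alpha>\<close>. If nothing were left,
  \<open>F\<close> would be \<open>[:- \<alpha>, 1:] ^ r\<close> with coefficient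
  \<open>of_nat r * - \<alpha>\<close> at index \<open>r - 1\<close>; in characteristic zero its
  vanishing forces \<open>\<alpha> = 0\<close>, and all lower coefficients would vanish.\<close>

lemma residue_splits:
  fixes F :: "'k::{alg_closed_field, field_char_0} poly"
  assumes "lead_coeff F = 1" "coeff F (degree F - 1) = 0" "i < degree F" "coeff F i \<noteq> 0"
  obtains A B U V where "F = A * B" "lead_coeff A = 1" "lead_coeff B = 1" "degree A > 0" "degree B > 0"
    "U * A + V * B = 1"
proof -
  have "degree F > 0" using assms(3) by simp
  then obtain \<alpha> where root: "poly F \<alpha> = 0" using alg_closed_imp_poly_has_root by blast
  have "F \<noteq> 0" using assms(4) by auto
  define r where "r = order \<alpha> F"
  define A where "A = [:- \<alpha>, 1:] ^ r"
  obtain B where B: "F = A * B" "\<not> [:- \<alpha>, 1:] dvd B"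
    using order_decomp[OF \<open>F \<noteq> 0\<close>, of \<alpha>] unfolding A_def r_def by blast
  have A: "lead_coeff A = 1" "degree A = r"
    by (simp_all add: A_def degree_linear_power coeff_linear_power)
  have "r > 0" using root \<open>F \<noteq> 0\<close> order_root[of F \<alpha>] by (simp add: r_def)
  have lB: "lead_coeff B = 1" using assms(1) A(1) unfolding B(1) by (simp add: lead_coeff_mult)
  have "degree B > 0"
  proof (rule ccontr)
    assume "\<not> degree B > 0"
    then have "degree B = 0" by simp
    then have "B = [:coeff B 0:]" by (rule degree_eq_zeroE) simp
    with lB \<open>degree B = 0\<close> have "B = 1" by (simp add: one_pCons)
    then have F: "F = [:- \<alpha>, 1:] ^ r" using B(1) by (simp add: A_def)
    then have "degree F = r" using A by (simp add: A_def)
    have "coeff F (r - 1) = of_nat r * - \<alpha>"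
      using \<open>r > 0\<close> unfolding F
      by (cases r) (auto simp: coeff_linear_poly_power simp del: power_Suc of_nat_Suc)
    with assms(2) \<open>degree F = r\<close> \<open>r > 0\<close> have "\<alpha> = 0" by simp
    then have "coeff F i = 0"
      using assms(3) \<open>degree F = r\<close> unfolding F by (subst coeff_linear_poly_power) auto
    with assms(4) show False by contradiction
  qed
  moreover have "poly B \<alpha> \<noteq> 0" using B(2) by (simp add: poly_eq_0_iff_dvd)
  then obtain U V where "U * A + V * B = 1"
    using bezout_linear_power[of B \<alpha> r] unfolding A_def by blast
  ultimately show ?thesis
    using that[OF B(1) A(1) lB] A(2) \<open>r > 0\<close> by blast
qed

section \<open>The induction on the degree\<close>

definition splits_over :: "'a::comm_ring_1 set \<Rightarrow> 'a poly \<Rightarrow> bool" where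
  "splits_over R P \<longleftrightarrow> (\<exists>xs. set xs \<subseteq> R \<and> length xs = degree P \<and> P = (\<Prod>x\<leftarrow>xs. [:- x, 1:]))"

theorem cone_ring_splits:
  fixes P :: "('k::{alg_closed_field, field_char_0}, 'n::{finite, linorder}) puiseux poly"
  assumes "\<And>i. coeff P i \<in> cone_ring" "lead_coeff P = 1"
  shows "splits_over cone_ring P"
  using assms
proof (induction "degree P" arbitrary: P rule: less_induct)
  case less
  define d where "d = degree P"
  show ?case
  proof (cases "d = 0")
    case True
    then have "P = 1" using less.prems(2) by (metis d_def degree_eq_zeroE lead_coeff_pCons(2) one_pCons)
    then show ?thesis by (auto simp: splits_over_def intro!: exI[of _ "[]"])
  next
    case False
    \<comment> \<open>\<open>b\<close> is to be the mean of the roots; translating by it removes the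
      coefficient of index \<open>d - 1\<close>. The scalar is written as a monomial with exponent
      \<open>0\<close>.\<close>
    define b :: "('k, 'n) puiseux" where "b = pmonom (- 1 / of_nat d) 0 * coeff P (d - 1)"
    have b: "b \<in> cone_ring"
      unfolding b_def by (intro cone_ring_mult cone_ring_pmonom less.prems) auto
    have db: "of_nat d * b = - coeff P (d - 1)"
      using False by (intro puiseux_eqI) (simp add: b_def puiseux_coeff_of_nat_mult coeff_pmonom_mult uminus_puiseux.rep_eq)
    define Q where "Q = pcompose P [:b, 1:]"
    have Qtop: "coeff Q d = 1" "\<And>j. j > d \<Longrightarrow> coeff Q j = 0" "coeff Q (d - Suc 0) = 0"
      using coeff_pcompose_shift[of P d b] less.prems(2) False db by (auto simp: Q_def d_def)
    have Q: "coeff Q i \<in> cone_ring" for i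
      unfolding Q_def by (rule coeff_pcompose_semiring_closed)
        (auto simp: coeff_pCons b less.prems cone_ring_add cone_ring_mult split: nat.splits)
    have PQ: "P = pcompose Q [:- b, 1:]"
      by (simp add: Q_def flip: pcompose_assoc) (simp add: pcompose_pCons)
    have "\<exists>ys. set ys \<subseteq> cone_ring \<and> length ys = d \<and> Q = (\<Prod>x\<leftarrow>ys. [:- x, 1:])"
    proof (cases "\<exists>i<d. coeff Q i \<noteq> 0")
      case False
      then have "coeff Q i = (if i = d then 1 else 0)" for i
        using Qtop(1,2) by (cases i d rule: linorder_cases) auto
      then have "Q = monom 1 d" by (simp add: poly_eq_iff)
      also have "\<dots> = (\<Prod>x\<leftarrow>replicate d 0. [:- x, 1:])"
        by (simp add: prod_list_replicate monom_altdef)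
      finally show ?thesis by (intro exI[of _ "replicate d 0"]) auto
    next
      case True
      then obtain i1 where i1: "i1 < d" "coeff Q i1 \<noteq> 0" by blast
      obtain c where c: "c \<in> rat_exp" "c \<in> lexnn"
        "\<And>i. i < d \<Longrightarrow> pmonom 1 (- (real (d - i) *\<^sub>R c)) * coeff Q i \<in> cone_ring"
        "\<exists>i<d. puiseux_coeff (coeff Q i) (real (d - i) *\<^sub>R c) \<noteq> 0"
        using newton_slope[OF Q i1] by blast
      define X Y :: "('k, 'n) puiseux" where "X = pmonom 1 c" and "Y = pmonom 1 (- c)"
      have XY: "X * Y = 1"
        unfolding X_def Y_def by (subst pmonom_mult) (auto simp: c rat_exp_uminus pmonom_one)
      have Ypow: "Y ^ k = pmonom 1 (- (real k *\<^sub>R c))" for k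
        unfolding Y_def by (simp add: pmonom_power c rat_exp_uminus)
      \<comment> \<open>\<open>G\<close> is \<open>Q\<close> after the substitution
        \<open>z = X * w\<close>, divided by \<open>X ^ d\<close>.\<close>
      define G where "G = Abs_poly (\<lambda>i. if i \<le> d then Y ^ (d - i) * coeff Q i else 0)"
      have Gc: "coeff G i = (if i \<le> d then Y ^ (d - i) * coeff Q i else 0)" for i
        unfolding G_def by (subst coeff_Abs_poly[of d]) auto
      have dG: "degree G = d"
        by (intro antisym degree_le le_degree) (auto simp: Gc Qtop)
      have lG: "lead_coeff G = 1" by (simp add: dG Gc Qtop)
      have G: "coeff G i \<in> cone_ring" for i
        using c(3)[of i] Qtop(1) unfolding Gc Ypow
        by (cases i d rule: linorder_cases) (auto simp: pmonom_one)
      let ?F = "map_poly (\<lambda>h. puiseux_coeff h 0) G"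
      have F: "coeff ?F i = puiseux_coeff (coeff G i) 0" for i
        by (simp add: coeff_map_poly zero_puiseux.rep_eq)
      have dF: "degree ?F = d"
        by (intro antisym degree_le le_degree)
          (auto simp: F Gc Qtop one_puiseux.rep_eq zero_puiseux.rep_eq)
      \<comment> \<open>The slope is attained at \<open>i2\<close>, so the residue \<open>?F\<close>
        has a non-zero coefficient below the top and \<open>residue_splits\<close> applies.\<close>
      obtain i2 where i2: "i2 < d" "puiseux_coeff (coeff Q i2) (real (d - i2) *\<^sub>R c) \<noteq> 0"
        using c(4) by blast
      have "coeff ?F i2 \<noteq> 0"
        using i2 c(1) unfolding F Gc Ypow
        by (simp add: coeff_pmonom_mult rat_exp_uminus rat_exp_scale_nat del: of_nat_diff)
      moreover have "lead_coeff ?F = 1" by (simp add: dF F Gc Qtop one_puiseux.rep_eq)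
      moreover have "coeff ?F (degree ?F - 1) = 0"
        by (simp add: dF F Gc Qtop zero_puiseux.rep_eq)
      ultimately obtain A0 B0 U V where AB0: "?F = A0 * B0" "lead_coeff A0 = 1" "lead_coeff B0 = 1"
        "degree A0 > 0" "degree B0 > 0" "U * A0 + V * B0 = 1"
        using residue_splits[of ?F i2] i2(1) dF by metis
      have "finite (range (coeff G))"
        by (rule finite_subset[of _ "insert 0 (coeff G ` {..d})"]) (auto simp: Gc)
      then obtain N p where p: "p \<ge> 1" "range (coeff G) \<subseteq> cone_series N p"
        using G cone_series_common[of "range (coeff G)"] by blast
      then have GNp: "coeff G i \<in> cone_series N p" for i by blast
      obtain A B where AB: "G = A * B" "lead_coeff A = 1" "lead_coeff B = 1"
        "degree A = degree A0" "degree B = degree B0"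
        "\<And>i. coeff A i \<in> cone_series N p" "\<And>i. coeff B i \<in> cone_series N p"
        using hensel[OF p(1) GNp lG AB0(1-6)] by metis
      have "A0 \<noteq> 0" "B0 \<noteq> 0" using AB0(4,5) by auto
      then have deg: "degree A + degree B = d"
        using dF unfolding AB0(1) AB(4,5) by (simp add: degree_mult_eq)
      have "splits_over cone_ring A" "splits_over cone_ring B"
        using AB(2-5) AB0(4,5) deg cone_ringI[OF p(1) AB(6)] cone_ringI[OF p(1) AB(7)]
        by (auto intro!: less.hyps simp flip: d_def)
      then obtain as bs where "set as \<subseteq> cone_ring" "length as = degree A" "A = (\<Prod>x\<leftarrow>as. [:- x, 1:])"
        "set bs \<subseteq> cone_ring" "length bs = degree B" "B = (\<Prod>x\<leftarrow>bs. [:- x, 1:])"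
        unfolding splits_over_def by blast
      then obtain ys where ys: "set ys \<subseteq> cone_ring" "length ys = d" "G = (\<Prod>x\<leftarrow>ys. [:- x, 1:])"
        using AB(1) deg that[of "as @ bs"] by auto
      \<comment> \<open>Undoing the scaling: the roots of \<open>Q\<close> are \<open>X\<close>
        times those of \<open>G\<close>, and remain in the ring because \<open>c\<close> is
        lexicographically non-negative.\<close>
      have "Q = smult (X ^ d) (pcompose G [:0, Y:])"
      proof (rule poly_eqI)
        fix i
        show "coeff Q i = coeff (smult (X ^ d) (pcompose G [:0, Y:])) i"
        proof (cases "i \<le> d")
          case True
          have "X ^ d * (Y ^ i * (Y ^ (d - i) * coeff Q i)) = (X * Y) ^ d * coeff Q i"
            using True by (simp add: power_mult_distrib mult.assoc flip: power_add mult.assoc[of "Y ^ i"])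
          with True show ?thesis by (simp add: coeff_pcompose_linear Gc XY)
        qed (use Qtop in \<open>simp add: coeff_pcompose_linear Gc\<close>)
      qed
      also have "\<dots> = (\<Prod>x\<leftarrow>map ((*) X) ys. [:- x, 1:])"
        using prod_list_scale[OF XY, of ys] by (simp add: ys(2,3) o_def)
      finally have "Q = (\<Prod>x\<leftarrow>map ((*) X) ys. [:- x, 1:])" .
      moreover have "set (map ((*) X) ys) \<subseteq> cone_ring"
        using ys(1) c by (auto simp: X_def intro!: cone_ring_mult cone_ring_pmonom)
      ultimately show ?thesis using ys(2) by (intro exI[of _ "map ((*) X) ys"]) auto
    qed
    then obtain ys where ys: "set ys \<subseteq> cone_ring" "length ys = d" "Q = (\<Prod>x\<leftarrow>ys. [:- x, 1:])"
      by blast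
    have "P = (\<Prod>x\<leftarrow>map ((+) b) ys. [:- x, 1:])"
      unfolding PQ ys(3) prod_list_pcompose
      by (simp add: pcompose_pCons o_def algebra_simps)
    moreover have "set (map ((+) b) ys) \<subseteq> cone_ring"
      using ys(1) b by (auto intro: cone_ring_add)
    ultimately show ?thesis
      using ys(2) unfolding splits_over_def d_def by (intro exI[of _ "map ((+) b) ys"]) auto
  qed
qed

section \<open>The pyramid\<close>

lemma linear_skew: "linear (\<lambda>a. \<chi> i. skew N a i)"
  by (rule linearI) (simp_all add: vec_eq_iff skew_add skew_scaleR)

text \<open>The forms are the coordinates of a linear isomorphism \<open>g\<close>, with inverse
  \<open>f\<close>, that carries the cone onto the orthant. The base is the image under
  \<open>f\<close> of the simplex spanned by \<open>Basis\<close>; it lies in the hyperplane where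
  the forms sum to \<open>1\<close>.\<close>

lemma skew_cone_is_pyramid:
  obtains D :: "(real, 'n::{finite, linorder}) vec set" where "pyramid_base D" "pyramid D = skew_cone N"
proof -
  define g where "g = (\<lambda>a :: (real, 'n) vec. \<chi> i. skew N a i)"
  have g: "linear g" unfolding g_def by (rule linear_skew)
  have "inj g"
    unfolding linear_injective_0[OF g]
  proof (intro allI impI)
    fix a assume "g a = 0"
    then have "skew N a i = 0" for i by (simp add: g_def vec_eq_iff)
    then show "a = 0" by (rule skew_eq_0)
  qed
  then obtain f where f: "linear f" "f \<circ> g = id" "g \<circ> f = id"
    using linear_injective_isomorphism[OF g] by (auto simp: fun_eq_iff)
  have fg: "f (g a) = a" "g (f a) = a" for a
    using f(2,3) by (simp_all add: fun_eq_iff)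
  have cone: "a \<in> skew_cone N \<longleftrightarrow> (\<forall>b\<in>Basis. 0 \<le> g a \<bullet> b)" for a
    by (auto simp: skew_cone_def g_def Basis_vec_def inner_axis)
  let ?E = "Basis :: (real, 'n) vec set"
  define D where "D = convex hull (f ` ?E)"
  have D: "a \<in> D \<longleftrightarrow> a \<in> skew_cone N \<and> g a \<bullet> One = 1" for a
  proof -
    have "D = f ` (convex hull ?E)"
      unfolding D_def by (rule convex_hull_linear_image[OF f(1), symmetric])
    then have "a \<in> D \<longleftrightarrow> g a \<in> convex hull ?E"
      using fg by (metis (no_types, lifting) image_iff)
    also have "\<dots> \<longleftrightarrow> (\<forall>b\<in>?E. 0 \<le> g a \<bullet> b) \<and> (\<Sum>b\<in>?E. g a \<bullet> b) = 1"
      unfolding convex_hull_finite[OF finite_Basis]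
    proof (intro iffI)
      assume "g a \<in> {y. \<exists>u. (\<forall>x\<in>?E. 0 \<le> u x) \<and> sum u ?E = 1 \<and> (\<Sum>x\<in>?E. u x *\<^sub>R x) = y}"
      then obtain u where u: "\<forall>x\<in>?E. 0 \<le> u x" "sum u ?E = 1" "(\<Sum>x\<in>?E. u x *\<^sub>R x) = g a" by blast
      have "g a \<bullet> b = u b" if "b \<in> ?E" for b
        using that by (simp flip: u(3))
      with u show "(\<forall>b\<in>?E. 0 \<le> g a \<bullet> b) \<and> (\<Sum>b\<in>?E. g a \<bullet> b) = 1" by simp
    next
      assume "(\<forall>b\<in>?E. 0 \<le> g a \<bullet> b) \<and> (\<Sum>b\<in>?E. g a \<bullet> b) = 1"
      then show "g a \<in> {y. \<exists>u. (\<forall>x\<in>?E. 0 \<le> u x) \<and> sum u ?E = 1 \<and> (\<Sum>x\<in>?E. u x *\<^sub>R x) = y}"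
        by (auto intro!: exI[of _ "\<lambda>b. g a \<bullet> b"] simp: euclidean_representation)
    qed
    finally show ?thesis by (simp add: cone inner_sum_right)
  qed
  have aff: "affine hull D = {a. g a \<bullet> One = 1}"
  proof -
    have "affine hull D = f ` (affine hull ?E)"
      unfolding D_def affine_hull_convex_hull by (rule affine_hull_linear_image[OF linear_conv_bounded_linear[THEN iffD1, OF f(1)], symmetric])
    then have "a \<in> affine hull D \<longleftrightarrow> g a \<in> affine hull ?E" for a
      using fg by (metis (no_types, lifting) image_iff)
    moreover have "x \<in> affine hull ?E \<longleftrightarrow> (\<Sum>b\<in>?E. x \<bullet> b) = 1" for x
      unfolding affine_hull_finite[OF finite_Basis]
    proof (intro iffI)
      assume "x \<in> {y. \<exists>u. sum u ?E = 1 \<and> (\<Sum>v\<in>?E. u v *\<^sub>R v) = y}"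
      then obtain u where u: "sum u ?E = 1" "(\<Sum>x\<in>?E. u x *\<^sub>R x) = x" by blast
      have "x \<bullet> b = u b" if "b \<in> ?E" for b
        using that by (simp flip: u(2))
      with u show "(\<Sum>b\<in>?E. x \<bullet> b) = 1" by simp
    next
      assume "(\<Sum>b\<in>?E. x \<bullet> b) = 1"
      then show "x \<in> {y. \<exists>u. sum u ?E = 1 \<and> (\<Sum>v\<in>?E. u v *\<^sub>R v) = y}"
        by (auto intro!: exI[of _ "\<lambda>b. x \<bullet> b"] simp: euclidean_representation)
    qed
    ultimately show ?thesis by (auto simp: inner_sum_right)
  qed
  \<comment> \<open>The adjoint provides a normal vector of the hyperplane.\<close>
  have adj: "g a \<bullet> One = adjoint g One \<bullet> a" for a
    using adjoint_works[OF g, of a One] by (simp add: inner_commute)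
  obtain e where e: "e \<in> ?E" using nonempty_Basis by blast
  have fe: "f e \<in> D" unfolding D_def using e by (intro hull_inc) auto
  have "adjoint g One \<noteq> 0"
    using fe D[of "f e"] adj[of "f e"] by auto
  moreover have "affine hull D = {x. adjoint g One \<bullet> x = 1}"
    unfolding aff adj ..
  moreover have "0 \<notin> affine hull D"
    by (simp add: aff linear_0[OF g])
  moreover have "finite (f ` ?E)" by simp
  ultimately have "pyramid_base D"
    unfolding pyramid_base_def using D_def by blast
  moreover have "pyramid D = skew_cone N"
  proof (intro set_eqI iffI)
    fix a assume "a \<in> pyramid D"
    then show "a \<in> skew_cone N"
      by (auto simp: pyramid_def D intro: cone_scaleR)
  next
    fix a :: "(real, 'n) vec" assume a: "a \<in> skew_cone N"
    show "a \<in> pyramid D"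
    proof (cases "a = 0")
      case True
      then show ?thesis using fe by (auto simp: pyramid_def intro!: bexI[of _ "f e"] exI[of _ 0])
    next
      case False
      have nn: "0 \<le> g a \<bullet> b" if "b \<in> ?E" for b using a that by (simp add: cone)
      have "g a \<noteq> 0" using False fg(1)[of a] linear_0[OF f(1)] by auto
      then obtain b where "b \<in> ?E" "g a \<bullet> b \<noteq> 0" using euclidean_eq_iff[of "g a" 0] by auto
      then have "0 < (\<Sum>b\<in>?E. g a \<bullet> b)"
        using nn by (intro sum_pos2[of _ b]) (auto simp: less_le)
      then have pos: "0 < g a \<bullet> One" by (simp add: inner_sum_right)
      \<comment> \<open>The sum of the forms is positive on the cone outside \<open>0\<close>;
        dividing by it moves \<open>a\<close> into the base.\<close>
      define t where "t = g a \<bullet> One"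
      have "(1 / t) *\<^sub>R a \<in> D"
        using pos a by (simp add: D linear_scale[OF g] cone_scaleR flip: t_def)
      moreover have "a = t *\<^sub>R ((1 / t) *\<^sub>R a)" using pos by (simp add: t_def)
      ultimately show ?thesis
        using pos unfolding pyramid_def t_def[symmetric] by (metis (mono_tags, lifting) UN_I less_imp_le mem_Collect_eq)
    qed
  qed
  ultimately show ?thesis by (rule that)
qed

section \<open>Roots of Weierstrass polynomials\<close>

lemma prod_list_map_eq_prod_nth:
  fixes g :: "'a \<Rightarrow> 'b::comm_monoid_mult"
  shows "(\<Prod>x\<leftarrow>xs. g x) = (\<Prod>j<length xs. g (xs ! j))"
  by (induction xs rule: rev_induct) (simp_all add: nth_append)

text \<open>The forms for \<open>N = 0\<close> are the coordinates, so \<open>skew_cone 0\<close> is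
  the orthant.\<close>

lemma puiseux_of_mfps_in_cone_ring: "puiseux_of_mfps f \<in> cone_ring"
  by (rule cone_ringI[of 1 _ 0])
     (auto simp: cone_series_def newton_diagram_def supp_def puiseux_of_mfps.rep_eq real_exp_def
       exp_lattice_def intro!: cone_nonneg split: if_splits)

theorem theorem3p1:
  fixes P :: "('k::{alg_closed_field, field_char_0}, 'n::{finite, linorder}) mfps poly"
  assumes "CARD('n) > 1"
    and "weierstrass_polynomial P"
    and "irreducible P"
  shows "\<exists>p\<ge>1. \<exists>i::'n. \<exists>\<Delta>::(real ^ 'n::{finite, linorder}) set.
    pyramid_base \<Delta> \<and>
    pyramid \<Delta> \<inter> {a. \<forall>j. a $ j \<le> 0} = {0} \<and>
    (\<exists>\<rho> :: nat \<Rightarrow> ('k, 'n) puiseux.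
      map_poly puiseux_of_mfps P = (\<Prod>j<degree P. [:- \<rho> j, 1:]) \<and>
      (\<forall>j<degree P. \<rho> j \<in> root_ring p i \<and> newton_diagram (\<rho> j) \<subseteq> pyramid \<Delta>))"
proof -
  let ?P = "map_poly puiseux_of_mfps P"
  have zero: "puiseux_of_mfps (0 :: ('k, 'n) mfps) = 0"
    using puiseux_of_mfps_add[of "0 :: ('k, 'n) mfps" 0] by simp
  have c: "coeff ?P i = puiseux_of_mfps (coeff P i)" for i
    by (simp add: coeff_map_poly zero)
  have l: "coeff ?P (degree P) = 1"
    using assms(2) by (simp add: c weierstrass_polynomial_def puiseux_of_mfps_one)
  then have deg: "degree ?P = degree P"
    by (intro antisym degree_le le_degree) (auto simp: c coeff_eq_0 zero)
  have "splits_over cone_ring ?P"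
    by (rule cone_ring_splits) (use l in \<open>auto simp: c deg puiseux_of_mfps_in_cone_ring\<close>)
  then obtain xs where xs: "set xs \<subseteq> cone_ring" "length xs = degree P" "?P = (\<Prod>x\<leftarrow>xs. [:- x, 1:])"
    unfolding splits_over_def deg by blast
  obtain N p where Np: "p \<ge> 1" "set xs \<subseteq> cone_series N p"
    using cone_series_common[OF finite_set xs(1)] by blast
  obtain D :: "(real, 'n) vec set" where D: "pyramid_base D" "pyramid D = skew_cone N"
    by (rule skew_cone_is_pyramid)
  \<comment> \<open>The first variable has no earlier forms, so \<open>skew N a i\<close> is
    \<open>a $ i\<close> and is non-negative on the cone, as a power series in this variable
    requires; the other variables may have negative exponents.\<close>
  define i where "i = Min (UNIV :: 'n set)"
  have i: "j = i" if "j \<le> i" for j using that by (simp add: i_def antisym)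
  have "?P = (\<Prod>j<degree P. [:- (xs ! j), 1:])"
    unfolding xs(3) prod_list_map_eq_prod_nth xs(2) ..
  moreover have "xs ! j \<in> root_ring p i \<and> newton_diagram (xs ! j) \<subseteq> pyramid D" if "j < degree P" for j
  proof -
    have x: "newton_diagram (xs ! j) \<subseteq> skew_cone N \<inter> exp_lattice p"
    proof -
      have "xs ! j \<in> cone_series N p"
        using that by (intro subsetD[OF Np(2)] nth_mem) (simp add: xs(2))
      then show ?thesis by (simp add: cone_series_def)
    qed
    have "0 \<le> a $ i" if "a \<in> skew_cone N" for a
    proof -
      have "j \<notin> {..<i}" for j using i[of j] less_imp_le[of j i] by auto
      then have "{..<i} = {}" by blast
      then have "skew N a i = a $ i" by (simp add: skew.simps[of N a i])
      moreover have "0 \<le> skew N a i" using that by (simp add: skew_cone_def)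
      ultimately show ?thesis by simp
    qed
    moreover have "puiseux_support (newton_diagram (xs ! j))"
      using puiseux_coeff[of "xs ! j"] by (simp add: newton_diagram_def)
    ultimately show ?thesis
      using x i unfolding root_ring_def root_support_iff[OF Np(1)] D(2) by blast
  qed
  moreover have "pyramid D \<inter> {a. \<forall>j. a $ j \<le> 0} = {0}"
    unfolding D(2) by (auto dest: cone_nonpos_eq_0)
  ultimately show ?thesis
    using Np(1) D(1) by blast
qed

end
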